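(* Consider the linear-Gaussian inverse problem on $\mathcal{H}$, its $n$-dimensional discretizations, and the ensemble Kalman approximation with ensemble size $J$, as described in the context. Let $\widehat\varepsilon_m=\mathbb{E}\|m_{\text{post}}-P^*\widehat m_{\text{post}}\|_{\mathcal{H}}$ be the expected error between the infinite-dimensional posterior mean and the ensemble posterior mean. Assume: (i) there are a constant $r_1\in\mathbb{R}$ and a function $\psi_1:\mathbb{N}\to\mathbb{R}$ with $\lim_{n\to\infty}\psi_1(n)=0$ such that $\|\mathcal{C}_0-P^*C_0P\|_{op}\le r_1\psi_1(n)$; (ii) there are a constant $r_2\in\mathbb{R}$ and a function $\psi_2:\mathbb{N}\to\mathbb{R}$ with $\lim_{n\to\infty}\psi_2(n)=0$ such that $\|\mathcal{F}-FP\|_{op}\le r_2\psi_2(n)$; (iii) there are a Hilbert space $\mathcal{H}'$ continuously embedded in $\mathcal{H}$, a constant $r_3\in\mathbb{R}$ and a function $\psi_3:\mathbb{N}\to\mathbb{R}$ with $\lim_{n\to\infty}\psi_3(n)=0$ such that $\|(I-P^*P)u\|_{\mathcal{H}}\le r_3\psi_3(n)\|u\|_{\mathcal{H}'}$ for every $u\in\mathcal{H}'$. Assume further that for $n$ sufficiently large $r_M(C_0)\le c\,r(\mathcal{C}_0)$ for some constant $c$ independent of $n$, and that $J\ge r_M(C_0)$. Then $$\widehat\varepsilon_m\le r_1'\psi_1(n)+r_2'\psi_2(n)+r_3'\psi_3(n)+r_4'\frac1{\sqrt J},$$ where the constants $r_1',r_2',r_3',r_4'$ are independent of $n$ and $J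$.
   Context: Continuum problem: $\mathcal{H}$ is an infinite-dimensional separable real Hilbert space, $\mathcal{F}:\mathcal{H}\to\mathbb{R}^{d_y}$ is linear and bounded, $\Gamma$ is a symmetric positive definite $d_y\times d_y$ matrix, $y\in\mathbb{R}^{d_y}$ is given data, and the prior is the Gaussian measure $\mathcal{N}(m_0,\mathcal{C}_0)$ on $\mathcal{H}$, with $\mathcal{C}_0$ a trace-class covariance operator and $m_0\in\mathrm{Im}(\mathcal{C}_0^{1/2})$. The posterior for the model $y=\mathcal{F}u+\eta$, $\eta\sim\mathcal{N}(0,\Gamma)$, is Gaussian with mean $m_{\text{post}}=m_0+\mathcal{C}_0\mathcal{F}^*(\mathcal{F}\mathcal{C}_0\mathcal{F}^*+\Gamma)^{-1}(y-\mathcal{F}m_0)$. Discretization (for each $n$; dependence on $n$ suppressed): $\mathcal{V}\subset\mathcal{H}$ is $n$-dimensional with basis $\phi_1,\dots,\phi_n$; $M_{ij}=\langle\phi_i,\phi_j\rangle_{\mathcal{H}}$; $\mathbb{R}^n_M$ is $\mathbb{R}^n$ with inner product $\langle\vec u,\vec v\rangle_M=\vec u^TM\vec v$; $P:\mathcal{H}\to\mathbb{R}^n_M$ sends $u$ to the coefficients of its orthogonal projection onto $\mathcal{V}$; $P^*\vec u=\sum_iu_i\phi_i$ is its adjoint. $F:\mathbb{R}^n_M\to\mathbb{R}^{d_y}$ is linear with adjoint $F^\natural=M^{-1}F^T$; $C_0:\mathbb{R}^n_M\to\mathbb{R}^n_M$ is an invertible covariance operator (self-adjoint, positive definite for $\langle\cdot,\cdot\rangle_M$);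 $\vec m_0=Pm_0$. Ensemble Kalman update (perturbed observations): $u^{(1)},\dots,u^{(J)}$ are independent draws from $\mathcal{N}(\vec m_0,C_0)$ on $\mathbb{R}^n_M$ (i.e. $u^{(j)}=\vec m_0+L\xi^{(j)}$, $\xi^{(j)}\sim\mathcal{N}(0,I)$ on $\mathbb{R}^n$, $C_0=LL^TM$), $\widehat m_0=\frac1J\sum_ju^{(j)}$, $\widehat C_0=\frac1{J-1}\sum_j(u^{(j)}-\widehat m_0)(u^{(j)}-\widehat m_0)^TM$, and $$v^{(j)}=u^{(j)}+\widehat C_0F^\natural(F\widehat C_0F^\natural+\Gamma)^{-1}(y-Fu^{(j)}+\eta^{(j)}),\qquad \eta^{(j)}\overset{\text{i.i.d.}}{\sim}\mathcal{N}(0,\Gamma),$$ with the $\eta^{(j)}$ independent of the $u^{(j)}$; $\widehat m_{\text{post}}=\frac1J\sum_{j=1}^Jv^{(j)}$. $\mathbb{E}$ is expectation over the $u^{(j)},\eta^{(j)}$. Effective dimensions: $r_M(C_0)=\mathrm{Tr}(C_0)/\|C_0\|_{op}$ with $\|\cdot\|_{op}$ the operator norm on $\mathbb{R}^n_M$; $r(\mathcal{C}_0)=\mathrm{Tr}(\mathcal{C}_0)/\|\mathcal{C}_0\|_{op}$ with the operator norm on $\mathcal{H}$. Elsewhere $\|\cdot\|_{op}$ is the operator norm between the relevant normed spaces.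
   Formalization: The prior mean m_0 is additionally assumed to lie in H'; without this the printed claim is false (e.g. H' trivial, ψ_3=0, F=0, where the error (I-P*P)m_0 need only decay like the square root of ψ_1). *)

theory Defs
  imports "HOL-Probability.Probability"
begin

section \<open>Operators on the Hilbert space\<close>

definition selfadjoint_op :: "('h::real_inner \<Rightarrow> 'h) \<Rightarrow> bool" where
  "selfadjoint_op T \<longleftrightarrow> (\<forall>x y. inner (T x) y = inner x (T y))"

definition psd_op :: "('h::real_inner \<Rightarrow> 'h) \<Rightarrow> bool" where
  "psd_op T \<longleftrightarrow> bounded_linear T \<and> selfadjoint_op T \<and> (\<forall>x. 0 \<le> inner (T x) x)"

definition orthonormal_basis :: "'h::real_inner set \<Rightarrow> bool" where
  "orthonormal_basis B \<longleftrightarrow>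
     pairwise orthogonal B \<and> (\<forall>e\<in>B. norm e = 1) \<and> closure (span B) = UNIV"

text \<open>For a positive operator \<open>T = |T|\<close>, so being trace class means that
  \<open>\<langle>T e, e\<rangle>\<close> is summable over an orthonormal basis. Neither summability nor
  the value of the sum depends on the basis.\<close>

definition trace_class_covariance :: "('h::real_inner \<Rightarrow> 'h) \<Rightarrow> bool" where
  "trace_class_covariance T \<longleftrightarrow>
     psd_op T \<and> (\<exists>B. orthonormal_basis B \<and> (\<lambda>e. inner (T e) e) summable_on B)"

definition op_trace :: "('h::real_inner \<Rightarrow> 'h) \<Rightarrow> real" where
  "op_trace T = (\<Sum>\<^sub>\<infinity>e\<in>(SOME B. orthonormal_basis B). inner (T e) e)"

definition op_sqrt :: "('h::real_inner \<Rightarrow> 'h) \<Rightarrow> 'h \<Rightarrow> 'h" where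
  "op_sqrt T = (THE S. psd_op S \<and> S \<circ> S = T)"

definition eff_dim :: "('h::real_inner \<Rightarrow> 'h) \<Rightarrow> real" where
  "eff_dim T = op_trace T / onorm T"

definition pos_def_matrix :: "real^'d^'d \<Rightarrow> bool" where
  "pos_def_matrix G \<longleftrightarrow> transpose G = G \<and> (\<forall>x. x \<noteq> 0 \<longrightarrow> 0 < inner x (G *v x))"

definition posterior_mean ::
  "('h::real_inner \<Rightarrow> real^'d) \<Rightarrow> real^'d^'d \<Rightarrow> ('h \<Rightarrow> 'h) \<Rightarrow> 'h \<Rightarrow> real^'d \<Rightarrow> 'h" where
  "posterior_mean Fc \<Gamma> Cc m0 y =
     m0 + Cc (adjoint Fc
       (matrix_inv (matrix (\<lambda>w. Fc (Cc (adjoint Fc w))) + \<Gamma>) *v (y - Fc m0)))"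


section \<open>Coordinates with respect to a basis of a finite-dimensional subspace\<close>

text \<open>As \<open>n\<close> varies, a vector of \<open>\<real>\<^sup>n\<close> is a function \<open>nat \<Rightarrow> real\<close> and an
  \<open>n \<times> n\<close> matrix a function \<open>nat \<Rightarrow> nat \<Rightarrow> real\<close>, of which only the values at
  indices in \<open>{..<n}\<close> matter. Indices start at \<open>0\<close>.\<close>

definition basis_family :: "nat \<Rightarrow> (nat \<Rightarrow> 'h::real_vector) \<Rightarrow> bool" where
  "basis_family n \<phi> \<longleftrightarrow> inj_on \<phi> {..<n} \<and> independent (\<phi> ` {..<n})"

definition gram :: "(nat \<Rightarrow> 'h::real_inner) \<Rightarrow> nat \<Rightarrow> nat \<Rightarrow> real" where
  "gram \<phi> i k = inner (\<phi> i) (\<phi> k)"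

definition inner_M :: "nat \<Rightarrow> (nat \<Rightarrow> 'h::real_inner) \<Rightarrow> (nat \<Rightarrow> real) \<Rightarrow> (nat \<Rightarrow> real) \<Rightarrow> real" where
  "inner_M n \<phi> x z = (\<Sum>i<n. \<Sum>k<n. x i * gram \<phi> i k * z k)"

definition norm_M :: "nat \<Rightarrow> (nat \<Rightarrow> 'h::real_inner) \<Rightarrow> (nat \<Rightarrow> real) \<Rightarrow> real" where
  "norm_M n \<phi> x = sqrt (inner_M n \<phi> x x)"

definition mat_vec :: "nat \<Rightarrow> (nat \<Rightarrow> nat \<Rightarrow> real) \<Rightarrow> (nat \<Rightarrow> real) \<Rightarrow> nat \<Rightarrow> real" where
  "mat_vec n A x = (\<lambda>i. \<Sum>k<n. A i k * x k)"

definition mat_inv :: "nat \<Rightarrow> (nat \<Rightarrow> nat \<Rightarrow> real) \<Rightarrow> nat \<Rightarrow> nat \<Rightarrow> real" where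
  "mat_inv n A = (THE B. (\<forall>i k. n \<le> i \<or> n \<le> k \<longrightarrow> B i k = 0) \<and>
     (\<forall>i<n. \<forall>k<n. (\<Sum>l<n. A i l * B l k) = (if i = k then 1 else 0)))"

definition opnorm_M :: "nat \<Rightarrow> (nat \<Rightarrow> 'h::real_inner) \<Rightarrow> (nat \<Rightarrow> nat \<Rightarrow> real) \<Rightarrow> real" where
  "opnorm_M n \<phi> A = (SUP x. norm_M n \<phi> (mat_vec n A x) / norm_M n \<phi> x)"

definition eff_dim_M :: "nat \<Rightarrow> (nat \<Rightarrow> 'h::real_inner) \<Rightarrow> (nat \<Rightarrow> nat \<Rightarrow> real) \<Rightarrow> real" where
  "eff_dim_M n \<phi> A = (\<Sum>i<n. A i i) / opnorm_M n \<phi> A"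

definition covariance_M :: "nat \<Rightarrow> (nat \<Rightarrow> 'h::real_inner) \<Rightarrow> (nat \<Rightarrow> nat \<Rightarrow> real) \<Rightarrow> bool" where
  "covariance_M n \<phi> A \<longleftrightarrow>
     (\<forall>x z. inner_M n \<phi> (mat_vec n A x) z = inner_M n \<phi> x (mat_vec n A z)) \<and>
     (\<forall>x. (\<exists>i<n. x i \<noteq> 0) \<longrightarrow> 0 < inner_M n \<phi> (mat_vec n A x) x)"

definition orth_proj :: "'h::real_inner set \<Rightarrow> 'h \<Rightarrow> 'h" where
  "orth_proj V u = (THE w. w \<in> V \<and> (\<forall>v\<in>V. inner (u - w) v = 0))"

text \<open>\<open>synth n \<phi>\<close> is \<open>P\<^sup>*\<close> and \<open>proj_coeffs n \<phi>\<close> is \<open>P\<close>.\<close>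

definition synth :: "nat \<Rightarrow> (nat \<Rightarrow> 'h::real_vector) \<Rightarrow> (nat \<Rightarrow> real) \<Rightarrow> 'h" where
  "synth n \<phi> x = (\<Sum>i<n. x i *\<^sub>R \<phi> i)"

definition proj_coeffs :: "nat \<Rightarrow> (nat \<Rightarrow> 'h::real_inner) \<Rightarrow> 'h \<Rightarrow> nat \<Rightarrow> real" where
  "proj_coeffs n \<phi> u =
     (THE x. (\<forall>i\<ge>n. x i = 0) \<and> synth n \<phi> x = orth_proj (span (\<phi> ` {..<n})) u)"

text \<open>A linear map from \<open>\<real>\<^sup>n\<close> to the data space is given by the columns \<open>F i\<close> of its
  matrix; \<open>fwd_adj\<close> is its adjoint \<open>M\<^sup>-\<^sup>1 F\<^sup>T\<close>.\<close>

definition fwd :: "nat \<Rightarrow> (nat \<Rightarrow> real^'d) \<Rightarrow> (nat \<Rightarrow> real) \<Rightarrow> real^'d" where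
  "fwd n F x = (\<Sum>i<n. x i *\<^sub>R F i)"

definition fwd_adj ::
  "nat \<Rightarrow> (nat \<Rightarrow> 'h::real_inner) \<Rightarrow> (nat \<Rightarrow> real^'d) \<Rightarrow> real^'d \<Rightarrow> nat \<Rightarrow> real" where
  "fwd_adj n \<phi> F w = mat_vec n (mat_inv n (gram \<phi>)) (\<lambda>k. inner (F k) w)"


section \<open>Ensemble Kalman update\<close>

definition ens_mean :: "nat \<Rightarrow> (nat \<Rightarrow> nat \<Rightarrow> real) \<Rightarrow> nat \<Rightarrow> real" where
  "ens_mean J u = (\<lambda>i. (\<Sum>j<J. u j i) / real J)"

definition ens_cov ::
  "nat \<Rightarrow> (nat \<Rightarrow> 'h::real_inner) \<Rightarrow> nat \<Rightarrow> (nat \<Rightarrow> nat \<Rightarrow> real) \<Rightarrow> nat \<Rightarrow> nat \<Rightarrow> real" where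
  "ens_cov n \<phi> J u = (\<lambda>i k. (\<Sum>j<J. (u j i - ens_mean J u i) *
       (\<Sum>l<n. (u j l - ens_mean J u l) * gram \<phi> l k)) / (real J - 1))"

definition kalman_gain ::
  "nat \<Rightarrow> (nat \<Rightarrow> 'h::real_inner) \<Rightarrow> (nat \<Rightarrow> real^'d) \<Rightarrow> real^'d^'d \<Rightarrow> (nat \<Rightarrow> nat \<Rightarrow> real)
     \<Rightarrow> real^'d \<Rightarrow> nat \<Rightarrow> real" where
  "kalman_gain n \<phi> F \<Gamma> C w =
     mat_vec n C (fwd_adj n \<phi> F
       (matrix_inv (matrix (\<lambda>z. fwd n F (mat_vec n C (fwd_adj n \<phi> F z))) + \<Gamma>) *v w))"

definition enkf_update ::
  "nat \<Rightarrow> (nat \<Rightarrow> 'h::real_inner) \<Rightarrow> (nat \<Rightarrow> real^'d) \<Rightarrow> real^'d^'d \<Rightarrow> real^'d \<Rightarrow> nat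
     \<Rightarrow> (nat \<Rightarrow> nat \<Rightarrow> real) \<Rightarrow> (nat \<Rightarrow> real^'d) \<Rightarrow> nat \<Rightarrow> nat \<Rightarrow> real" where
  "enkf_update n \<phi> F \<Gamma> y J u \<eta> j =
     (\<lambda>i. u j i + kalman_gain n \<phi> F \<Gamma> (ens_cov n \<phi> J u) (y - fwd n F (u j) + \<eta> j) i)"

definition enkf_mean ::
  "nat \<Rightarrow> (nat \<Rightarrow> 'h::real_inner) \<Rightarrow> (nat \<Rightarrow> real^'d) \<Rightarrow> real^'d^'d \<Rightarrow> real^'d \<Rightarrow> nat
     \<Rightarrow> (nat \<Rightarrow> nat \<Rightarrow> real) \<Rightarrow> (nat \<Rightarrow> real^'d) \<Rightarrow> nat \<Rightarrow> real" where
  "enkf_mean n \<phi> F \<Gamma> y J u \<eta> = ens_mean J (enkf_update n \<phi> F \<Gamma> y J u \<eta>)"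


section \<open>Random ensembles\<close>

definition std_gaussian :: "'i set \<Rightarrow> ('i \<Rightarrow> real) measure" where
  "std_gaussian I = PiM I (\<lambda>_. density lborel (\<lambda>x. ennreal (std_normal_density x)))"

abbreviation Rn_borel :: "nat \<Rightarrow> (nat \<Rightarrow> real) measure" where
  "Rn_borel n \<equiv> PiM {..<n} (\<lambda>_. borel)"

text \<open>\<open>gaussian_M n \<phi> m C \<mu>\<close>: \<open>\<mu>\<close> is the law of \<open>m + L \<xi>\<close> with \<open>C = L L\<^sup>T M\<close>
  and \<open>\<xi>\<close> standard Gaussian on \<open>\<real>\<^sup>n\<close>; the law does not depend on the choice of \<open>L\<close>.\<close>

definition gaussian_M ::
  "nat \<Rightarrow> (nat \<Rightarrow> 'h::real_inner) \<Rightarrow> (nat \<Rightarrow> real) \<Rightarrow> (nat \<Rightarrow> nat \<Rightarrow> real)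
     \<Rightarrow> (nat \<Rightarrow> real) measure \<Rightarrow> bool" where
  "gaussian_M n \<phi> m C \<mu> \<longleftrightarrow> (\<exists>L.
     (\<forall>i<n. \<forall>k<n. C i k = (\<Sum>p<n. (\<Sum>l<n. L i l * L p l) * gram \<phi> p k)) \<and>
     \<mu> = distr (std_gaussian {..<n}) (Rn_borel n)
           (\<lambda>\<xi>. \<lambda>i\<in>{..<n}. m i + mat_vec n L \<xi> i))"

definition gaussian_noise :: "real^'d^'d \<Rightarrow> (real^'d) measure \<Rightarrow> bool" where
  "gaussian_noise \<Gamma> \<mu> \<longleftrightarrow> (\<exists>S :: real^'d^'d. \<Gamma> = S ** transpose S \<and>
     \<mu> = distr (std_gaussian UNIV) borel (\<lambda>\<zeta>. S *v (\<chi> i. \<zeta> i)))"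

text \<open>The three independence clauses say: the \<open>u j\<close> are independent, the \<open>\<eta> j\<close> are
  independent, and the sigma-algebras generated by all \<open>u j\<close> and by all \<open>\<eta> j\<close> are independent.\<close>

definition enkf_ensemble ::
  "'w measure \<Rightarrow> nat \<Rightarrow> (nat \<Rightarrow> 'h::real_inner) \<Rightarrow> (nat \<Rightarrow> real) \<Rightarrow> (nat \<Rightarrow> nat \<Rightarrow> real)
     \<Rightarrow> real^'d^'d \<Rightarrow> nat \<Rightarrow> (nat \<Rightarrow> 'w \<Rightarrow> nat \<Rightarrow> real) \<Rightarrow> (nat \<Rightarrow> 'w \<Rightarrow> real^'d) \<Rightarrow> bool" where
  "enkf_ensemble \<Omega> n \<phi> m C \<Gamma> J u \<eta> \<longleftrightarrow>
     prob_space \<Omega> \<and>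
     (\<forall>j<J. gaussian_M n \<phi> m C (distr \<Omega> (Rn_borel n) (u j))) \<and>
     (\<forall>j<J. gaussian_noise \<Gamma> (distr \<Omega> borel (\<eta> j))) \<and>
     prob_space.indep_vars \<Omega> (\<lambda>_. Rn_borel n) u {..<J} \<and>
     prob_space.indep_vars \<Omega> (\<lambda>_. borel) \<eta> {..<J} \<and>
     prob_space.indep_set \<Omega>
       (sets (vimage_algebra (space \<Omega>) (\<lambda>\<omega>. \<lambda>j\<in>{..<J}. u j \<omega>)
         (PiM {..<J} (\<lambda>_. Rn_borel n))))
       (sets (vimage_algebra (space \<Omega>) (\<lambda>\<omega>. \<lambda>j\<in>{..<J}. \<eta> j \<omega>)
         (PiM {..<J} (\<lambda>_. borel))))"

end

theory Submission
  imports Defs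
begin

text \<open>Through the synthesis map everything is transported to the Hilbert space, where the
  ensemble Kalman mean becomes a Kalman update with the sample covariance of the embedded ensemble
  and the operator \<open>FP\<close>, whose adjoint is \<open>P\<^sup>*F\<^sup>\<natural>\<close>. Since \<open>\<Gamma>\<close> is bounded below, the gain depends
  Lipschitz continuously on the covariance and on the forward operator, with constants that do
  not involve the sample covariance. This reduces the error, path by path, to the three
  discretization errors and to the sampling errors of the ensemble mean, the ensemble covariance
  and the noise mean. The covariance error is measured in the Hilbert--Schmidt norm, whose mean
  square is \<open>O((tr C)\<^sup>2 / J)\<close> by an exact fourth moment computation; the trace is the effective
  dimension times the operator norm, hence bounded uniformly in \<open>n\<close>. No concentration
  inequality is needed, because the constants may depend on the trace.\<close>

section \<open>Finite orthonormal families\<close>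

text \<open>The obstacle is that sampling errors multiply each other: a random gain acts on a random
  innovation, while the constants must be free of n and J. The pathwise estimate is therefore
  arranged so that the ensemble mean error X, the covariance error D and the size N of the noise
  mean occur in terms of degree at most two. Linear terms become squares through t <= s t^2 + 1/s
  with s = sqrt J; products such as D X are quadratic already. The single random quantity R = X^2 +
  D^2 + N^2 then controls everything, and E R = O(1/J) yields the rate 1/sqrt J. The Hilbert-Schmidt
  norm fits this plan because its square is a finite sum of squared averages of independent
  variables; the dimension of the subspace drops out when that sum is bounded by the square of the
  trace. Centring the ensemble at its exact mean, the projection of m0, gives these averages mean
  zero. The empirical centring in the sample covariance then costs only X^2 and a term of order
  1/J.\<close>

definition orthonormal_set :: "'h::real_inner set \<Rightarrow> bool" where
  "orthonormal_set E \<longleftrightarrow> finite E \<and> pairwise orthogonal E \<and> (\<forall>e\<in>E. norm e = 1)"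

lemma orthonormal_set_finite: "orthonormal_set E \<Longrightarrow> finite E"
  by (simp add: orthonormal_set_def)

lemma inner_orthonormal_set:
  "orthonormal_set E \<Longrightarrow> e \<in> E \<Longrightarrow> f \<in> E \<Longrightarrow> inner e f = (if e = f then 1 else 0)"
  by (auto simp: orthonormal_set_def pairwise_def orthogonal_def power2_norm_eq_inner[symmetric])

lemma orthonormal_set_exists:
  fixes B :: "'h::real_inner set"
  assumes "finite B"
  obtains E where "orthonormal_set E" "span E = span B"
proof -
  obtain D where D: "finite D" "span D = span B" "pairwise orthogonal D"
    using basis_orthogonal[OF assms] by blast
  \<comment> \<open>The orthogonal set \<open>D\<close> may contain 0, which cannot be normalised
    and does not change the span.\<close>
  define E where "E = (\<lambda>x. x /\<^sub>R norm x) ` (D - {0})"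
  have "span E = span (D - {0})"
    unfolding E_def
    by (rule span_image_scale) (use D in auto)
  then have "span E = span B"
    using D(2) by simp
  moreover have "orthonormal_set E"
    using D by (auto simp: orthonormal_set_def E_def pairwise_def orthogonal_def)
  ultimately show thesis
    using that by blast
qed

lemma inner_sum_orthonormal_set:
  assumes "orthonormal_set E" "f \<in> E"
  shows "inner (\<Sum>e\<in>E. c e *\<^sub>R e) f = c f"
proof -
  have "inner (\<Sum>e\<in>E. c e *\<^sub>R e) f = (\<Sum>e\<in>E. if e = f then c e else 0)"
    unfolding inner_sum_left
    by (rule sum.cong) (simp_all add: inner_orthonormal_set[OF assms(1) _ assms(2)])
  then show ?thesis
    using assms by (simp add: orthonormal_set_finite)
qed

lemma orthonormal_set_residual:
  assumes E: "orthonormal_set E" and v: "v \<in> span E"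
  shows "inner (u - (\<Sum>e\<in>E. inner u e *\<^sub>R e)) v = 0"
  using v
proof (induction rule: span_induct_alt)
  case (step c x y)
  then show ?case
    using inner_sum_orthonormal_set[OF E step(1), of "inner u"]
    by (simp add: inner_add_right inner_diff_left)
qed simp

lemma orthonormal_set_sum_in_span: "(\<Sum>e\<in>E. c e *\<^sub>R e) \<in> span E"
  by (intro span_sum span_scale span_base)

lemma orthonormal_set_expansion:
  assumes E: "orthonormal_set E" and v: "v \<in> span E"
  shows "(\<Sum>e\<in>E. inner v e *\<^sub>R e) = v"
proof -
  have "v - (\<Sum>e\<in>E. inner v e *\<^sub>R e) \<in> span E"
    by (intro span_diff v orthonormal_set_sum_in_span)
  from orthonormal_set_residual[OF E this, of v] show ?thesis
    by simp
qed

lemma parseval_orthonormal_set: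
  assumes E: "orthonormal_set E" and v: "v \<in> span E"
  shows "inner u v = (\<Sum>e\<in>E. inner u e * inner v e)"
  by (subst orthonormal_set_expansion[OF E v, symmetric])
    (simp add: inner_sum_right mult.commute)

lemma norm_square_orthonormal_set:
  assumes "orthonormal_set E" "v \<in> span E"
  shows "(norm v)\<^sup>2 = (\<Sum>e\<in>E. (inner v e)\<^sup>2)"
  unfolding power2_norm_eq_inner parseval_orthonormal_set[OF assms]
  by (simp add: power2_eq_square)

lemma bessel_orthonormal_set:
  assumes E: "orthonormal_set E"
  shows "(\<Sum>e\<in>E. (inner u e)\<^sup>2) \<le> (norm u)\<^sup>2"
proof -
  let ?p = "\<Sum>e\<in>E. inner u e *\<^sub>R e"
  have "inner (u - ?p) ?p = 0"
    by (rule orthonormal_set_residual[OF E orthonormal_set_sum_in_span])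
  then have "(norm u)\<^sup>2 = (norm (u - ?p))\<^sup>2 + inner u ?p"
    by (simp add: power2_norm_eq_inner inner_diff_left inner_diff_right inner_commute)
  moreover have "inner u ?p = (\<Sum>e\<in>E. (inner u e)\<^sup>2)"
    by (simp add: inner_sum_right power2_eq_square)
  ultimately show ?thesis
    by simp
qed

section \<open>The Riesz representation and adjoints\<close>

text \<open>The representer is the minimiser of the energy |x|^2/2 - f x. The energy is bounded
  below, a minimising sequence is Cauchy by the parallelogram law, completeness supplies its limit,
  and the vanishing first variation there is the claimed identity.\<close>

lemma riesz_representation:
  fixes f :: "'h::{real_inner, complete_space} \<Rightarrow> real"
  assumes f: "bounded_linear f"
  shows "\<exists>v. \<forall>x. f x = inner x v"
proof -
  interpret f: bounded_linear f by fact
  define q where "q x = (norm x)\<^sup>2 / 2 - f x" for x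
  obtain K where K: "\<And>x. norm (f x) \<le> norm x * K"
    using f.bounded by blast
  have lb: "- (K\<^sup>2 / 2) \<le> q x" for x
  proof -
    have "f x \<le> norm x * K" using K[of x] by simp
    moreover have "0 \<le> (norm x - K)\<^sup>2" by simp
    ultimately show ?thesis
      by (simp add: q_def power2_eq_square algebra_simps)
  qed
  define I where "I = (INF x. q x)"
  have bdd: "bdd_below (range q)"
    using lb by (auto intro!: bdd_belowI)
  have I_le: "I \<le> q x" for x
    unfolding I_def by (rule cINF_lower[OF bdd]) simp
  have "\<exists>x. q x < I + 1 / real (Suc n)" for n
  proof (rule ccontr)
    assume "\<not> ?thesis"
    then have "I + 1 / real (Suc n) \<le> I"
      unfolding I_def by (intro cINF_greatest) (auto simp: not_less I_def)
    then show False by (simp add: field_simps)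
  qed
  then obtain X where X: "\<And>n. q (X n) < I + 1 / real (Suc n)"
    by metis
  have near: "(norm (X m - X n))\<^sup>2 \<le> 4 / real (Suc m) + 4 / real (Suc n)" for m n
  proof -
    let ?z = "(1/2) *\<^sub>R (X m + X n)"
    \<comment> \<open>Parallelogram law for two points and their midpoint: the contributions of
      \<open>f\<close> cancel, and the midpoint value is at least the infimum.\<close>
    have "(norm (X m - X n))\<^sup>2 = 4 * q (X m) + 4 * q (X n) - 8 * q ?z"
      unfolding q_def f.add f.scaleR
      by (simp add: power2_norm_eq_inner inner_diff_left inner_diff_right
          inner_add_left inner_add_right inner_commute field_simps)
    also have "\<dots> \<le> 4 * q (X m) + 4 * q (X n) - 8 * I"
      using I_le[of ?z] by simp
    also have "\<dots> \<le> 4 / real (Suc m) + 4 / real (Suc n)"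
    proof -
      have "4 / real (Suc k) = 4 * (1 / real (Suc k))" for k
        by simp
      with X[of m] X[of n] show "4 * q (X m) + 4 * q (X n) - 8 * I \<le>
          4 / real (Suc m) + 4 / real (Suc n)"
        by (smt (verit))
    qed
    finally show ?thesis .
  qed
  have "Cauchy X"
  proof (rule metric_CauchyI)
    fix e :: real
    assume e: "0 < e"
    obtain M :: nat where M: "8 / e\<^sup>2 < real M"
      using reals_Archimedean2 by blast
    show "\<exists>M. \<forall>m\<ge>M. \<forall>n\<ge>M. dist (X m) (X n) < e"
    proof (intro exI allI impI)
      fix m n
      assume mn: "M \<le> m" "M \<le> n"
      have "0 < real M"
        using M e by (smt (verit) divide_nonneg_nonneg zero_le_power2)
      then have "4 / real (Suc m) \<le> 4 / real M" "4 / real (Suc n) \<le> 4 / real M"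
        using mn by (auto intro!: divide_left_mono)
      moreover have "8 / real M < e\<^sup>2"
        using M e \<open>0 < real M\<close> by (simp add: field_simps)
      ultimately have "(norm (X m - X n))\<^sup>2 < e\<^sup>2"
        using near[of m n] by simp
      then show "dist (X m) (X n) < e"
        using e by (simp add: dist_norm power2_less_imp_less)
    qed
  qed
  then obtain v where v: "X \<longlonglongrightarrow> v"
    using Cauchy_convergent unfolding convergent_def by blast
  have "(\<lambda>n. q (X n)) \<longlonglongrightarrow> q v"
    unfolding q_def by (intro tendsto_intros v f.tendsto) simp
  moreover have "(\<lambda>n. I + 1 / real (Suc n)) \<longlonglongrightarrow> I + 0"
    by (intro tendsto_intros LIMSEQ_Suc[OF lim_1_over_n])
  ultimately have "q v \<le> I"
    using LIMSEQ_le[of "\<lambda>n. q (X n)" "q v" "\<lambda>n. I + 1 / real (Suc n)" I] X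
    by (auto intro: less_imp_le)
  then have min: "q v \<le> q x" for x
    using I_le[of x] by simp
  have "f x = inner x v" for x
  proof -
    define b where "b = inner x v - f x"
    have "0 \<le> b * t + ((norm x)\<^sup>2 / 2) * t\<^sup>2" for t
    proof -
      have "q (v + t *\<^sub>R x) = q v + b * t + ((norm x)\<^sup>2 / 2) * t\<^sup>2"
        unfolding q_def b_def f.add f.scaleR power2_norm_eq_inner
        by (simp add: inner_add_left inner_add_right inner_commute[of v x] power2_eq_square
            algebra_simps add_divide_distrib)
      then show ?thesis using min[of "v + t *\<^sub>R x"] by simp
    qed
    note * = this
    have "b = 0"
    proof (cases "x = 0")
      case True
      then show ?thesis by (simp add: b_def f.zero)
    next
      case False
      \<comment> \<open>The chosen t minimises the quadratic; its value there is -b^2/(2 |x|^2),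
        which forces b = 0.\<close>
      have "0 \<le> b * (- b / (norm x)\<^sup>2) + ((norm x)\<^sup>2 / 2) * (- b / (norm x)\<^sup>2)\<^sup>2"
        by (rule *)
      also have "\<dots> = - (b\<^sup>2 / (2 * (norm x)\<^sup>2))"
        using False by (simp add: field_simps power2_eq_square)
      finally show ?thesis
        using False by (simp add: field_simps)
    qed
    then show ?thesis by (simp add: b_def)
  qed
  then show ?thesis by blast
qed

text \<open>\<open>adjoint\<close> is a choice operator, so its defining identity needs a witness;
  Riesz representation of x -> <f x, w> provides one for each \<open>w\<close>.\<close>

lemma inner_adjoint:
  fixes f :: "'h::{real_inner, complete_space} \<Rightarrow> 'e::real_inner"
  assumes "bounded_linear f"
  shows "inner (f x) w = inner x (adjoint f w)"
proof -
  have "\<exists>v. \<forall>x. inner (f x) w = inner x v" for w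
    by (rule riesz_representation)
      (intro bounded_linear_compose[OF bounded_linear_inner_left assms])
  then have "\<exists>f'. \<forall>x w. inner (f x) w = inner x (f' w)"
    by metis
  then show ?thesis
    unfolding adjoint_def by (rule someI2_ex) blast
qed

text \<open>Adjointness is kept as a relation between \<open>G\<close> and \<open>G'\<close>, so
  that the same estimates serve \<open>adjoint Fc\<close> and the coordinate adjoint built from the
  inverse Gram matrix.\<close>

lemma adjoint_pair_linear:
  assumes adj: "\<And>h w. inner (G h) w = inner h (G' w)"
  shows "linear G'"
proof (rule linearI)
  fix v w
  have "inner h (G' (v + w) - (G' v + G' w)) = 0" for h
    by (simp add: inner_diff_right inner_add_right flip: adj)
  from this[of "G' (v + w) - (G' v + G' w)"] show "G' (v + w) = G' v + G' w"
    by simp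
next
  fix c w
  have "inner h (G' (c *\<^sub>R w) - c *\<^sub>R G' w) = 0" for h
    by (simp add: inner_diff_right flip: adj)
  from this[of "G' (c *\<^sub>R w) - c *\<^sub>R G' w"] show "G' (c *\<^sub>R w) = c *\<^sub>R G' w"
    by simp
qed

lemma adjoint_pair_norm_le:
  assumes adj: "\<And>h w. inner (G h) w = inner h (G' w)"
    and le: "\<And>h. norm (G h) \<le> g * norm h" and g: "0 \<le> g"
  shows "norm (G' w) \<le> g * norm w"
proof (cases "G' w = 0")
  case True
  with g show ?thesis by simp
next
  case False
  have "(norm (G' w))\<^sup>2 = inner (G (G' w)) w"
    by (simp add: adj power2_norm_eq_inner)
  also have "\<dots> \<le> norm (G (G' w)) * norm w"
    by (rule norm_cauchy_schwarz)
  also have "\<dots> \<le> (g * norm (G' w)) * norm w"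
    by (intro mult_right_mono le) simp
  finally show ?thesis
    using False by (simp add: power2_eq_square)
qed

section \<open>Coordinates with respect to a finite basis\<close>

locale finite_basis =
  fixes n :: nat and \<phi> :: "nat \<Rightarrow> 'h::real_inner"
  assumes basis: "basis_family n \<phi>"
begin

abbreviation "V \<equiv> span (\<phi> ` {..<n})"

lemma synth_in_V: "synth n \<phi> x \<in> V"
  unfolding synth_def by (intro span_sum span_scale span_base) auto

lemma basis_in_V: "i < n \<Longrightarrow> \<phi> i \<in> V"
  by (intro span_base) auto

lemma synth_cong: "(\<And>i. i < n \<Longrightarrow> x i = z i) \<Longrightarrow> synth n \<phi> x = synth n \<phi> z"
  unfolding synth_def by (rule sum.cong) auto

text \<open>Independence concerns the set of basis vectors; injectivity of the indexing allows
  coefficients on indices to be read as coefficients on vectors.\<close>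

lemma synth_eq_0: "synth n \<phi> x = 0 \<Longrightarrow> i < n \<Longrightarrow> x i = 0"
proof -
  assume 0: "synth n \<phi> x = 0" and i: "i < n"
  have inj: "inj_on \<phi> {..<n}" and ind: "independent (\<phi> ` {..<n})"
    using basis by (auto simp: basis_family_def)
  define c where "c v = x (the_inv_into {..<n} \<phi> v)" for v
  have "(\<Sum>v\<in>\<phi> ` {..<n}. c v *\<^sub>R v) = synth n \<phi> x"
    unfolding synth_def sum.reindex[OF inj] c_def
    by (rule sum.cong) (auto simp: the_inv_into_f_f[OF inj])
  with 0 ind i have "c (\<phi> i) = 0"
    by (intro independentD[OF ind, of "\<phi> ` {..<n}"]) auto
  with i show ?thesis
    by (simp add: c_def the_inv_into_f_f[OF inj])
qed

lemma synth_diff: "synth n \<phi> (\<lambda>i. x i - z i) = synth n \<phi> x - synth n \<phi> z"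
  by (simp add: synth_def scaleR_diff_left sum_subtractf)

lemma synth_inj: "synth n \<phi> x = synth n \<phi> z \<Longrightarrow> i < n \<Longrightarrow> x i = z i"
  using synth_eq_0[of "\<lambda>i. x i - z i" i] by (simp add: synth_diff)

lemma synth_surj:
  assumes "v \<in> V" shows "\<exists>x. (\<forall>i\<ge>n. x i = 0) \<and> synth n \<phi> x = v"
proof -
  have "\<exists>x. synth n \<phi> x = v"
    using assms
  proof (induction rule: span_induct_alt)
    case base
    show ?case by (rule exI[of _ "\<lambda>_. 0"]) (simp add: synth_def)
  next
    case (step c u v)
    then obtain i x where i: "i < n" "u = \<phi> i" and x: "synth n \<phi> x = v"
      by auto
    have "synth n \<phi> (\<lambda>k. c * (if k = i then 1 else 0) + x k) = c *\<^sub>R u + v"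
      using i x
      by (simp add: synth_def scaleR_add_left sum.distrib if_distrib[of "\<lambda>a. (c * a) *\<^sub>R _"]
          if_distribR cong: if_cong)
    then show ?case by blast
  qed
  then obtain x where x: "synth n \<phi> x = v" by blast
  have "synth n \<phi> (\<lambda>i. if i < n then x i else 0) = v"
    using x synth_cong[of x "\<lambda>i. if i < n then x i else 0"] by simp
  then show ?thesis
    by (intro exI[of _ "\<lambda>i. if i < n then x i else 0"]) auto
qed

lemma orth_proj_unique:
  assumes "w \<in> V" "\<And>v. v \<in> V \<Longrightarrow> inner (u - w) v = 0"
  shows "orth_proj V u = w"
  unfolding orth_proj_def
proof (rule the_equality)
  fix w'
  assume w': "w' \<in> V \<and> (\<forall>v\<in>V. inner (u - w') v = 0)"
  then have "w' - w \<in> V"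
    using assms(1) by (simp add: span_diff)
  then have "inner (u - w) (w' - w) = 0" "inner (u - w') (w' - w) = 0"
    using assms(2) w' by auto
  then have "inner (w' - w) (w' - w) = 0"
    by (simp add: inner_diff_left)
  then show "w' = w" by simp
qed (use assms in blast)

lemma orth_proj_in_V: "orth_proj V u \<in> V"
  and orth_proj_residual: "v \<in> V \<Longrightarrow> inner (u - orth_proj V u) v = 0"
proof -
  obtain E where E: "orthonormal_set E" "span E = V"
    using orthonormal_set_exists[of "\<phi> ` {..<n}"] by auto
  have *: "orth_proj V u = (\<Sum>e\<in>E. inner u e *\<^sub>R e)"
    by (rule orth_proj_unique)
      (use E orthonormal_set_residual[OF E(1)] orthonormal_set_sum_in_span[of _ E] in auto)
  show "orth_proj V u \<in> V"
    unfolding * using orthonormal_set_sum_in_span[of _ E] E(2) by simp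
  show "v \<in> V \<Longrightarrow> inner (u - orth_proj V u) v = 0"
    unfolding * using orthonormal_set_residual[OF E(1)] E(2) by simp
qed

lemma orth_proj_ident: "v \<in> V \<Longrightarrow> orth_proj V v = v"
  by (rule orth_proj_unique) auto

lemma inner_orth_proj: "v \<in> V \<Longrightarrow> inner v (orth_proj V u) = inner v u"
  using orth_proj_residual[of v u]
  by (simp only: inner_commute[of _ v] inner_diff_right) simp

lemma orth_proj_linear: "linear (orth_proj V)"
proof (rule linearI)
  fix u v
  show "orth_proj V (u + v) = orth_proj V u + orth_proj V v"
    using orth_proj_residual[of _ u] orth_proj_residual[of _ v]
    by (intro orth_proj_unique span_add orth_proj_in_V)
      (simp add: inner_add_left inner_diff_left)
next
  fix c u
  show "orth_proj V (c *\<^sub>R u) = c *\<^sub>R orth_proj V u"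
    using orth_proj_residual[of _ u]
    by (intro orth_proj_unique span_scale orth_proj_in_V)
      (simp add: inner_diff_left)
qed

lemma proj_coeffs_eq_0: "n \<le> i \<Longrightarrow> proj_coeffs n \<phi> u i = 0"
  and synth_proj_coeffs: "synth n \<phi> (proj_coeffs n \<phi> u) = orth_proj V u"
proof -
  have "\<exists>!x. (\<forall>i\<ge>n. x i = 0) \<and> synth n \<phi> x = orth_proj V u"
  proof (rule ex_ex1I)
    show "\<exists>x. (\<forall>i\<ge>n. x i = 0) \<and> synth n \<phi> x = orth_proj V u"
      by (rule synth_surj[OF orth_proj_in_V])
  next
    fix x z
    assume *: "(\<forall>i\<ge>n. x i = 0) \<and> synth n \<phi> x = orth_proj V u"
      "(\<forall>i\<ge>n. z i = 0) \<and> synth n \<phi> z = orth_proj V u"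
    show "x = z"
    proof
      fix i
      show "x i = z i"
        using * synth_inj[of x z i] by (cases "i < n") auto
    qed
  qed
  from theI'[OF this] show "n \<le> i \<Longrightarrow> proj_coeffs n \<phi> u i = 0"
    "synth n \<phi> (proj_coeffs n \<phi> u) = orth_proj V u"
    by (auto simp: proj_coeffs_def)
qed

lemma proj_coeffs_synth: "i < n \<Longrightarrow> proj_coeffs n \<phi> (synth n \<phi> x) i = x i"
  by (rule synth_inj) (auto simp: synth_proj_coeffs orth_proj_ident synth_in_V)

lemma proj_coeffs_orth_proj: "proj_coeffs n \<phi> (orth_proj V u) = proj_coeffs n \<phi> u"
  unfolding proj_coeffs_def by (simp add: orth_proj_ident orth_proj_in_V)

lemma proj_coeffs_linear: "linear (\<lambda>u. proj_coeffs n \<phi> u i)"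
proof (cases "i < n")
  case True
  show ?thesis
  proof (rule linearI)
    fix u v
    have "synth n \<phi> (proj_coeffs n \<phi> (u + v)) =
        synth n \<phi> (\<lambda>i. proj_coeffs n \<phi> u i + proj_coeffs n \<phi> v i)"
      by (simp add: synth_proj_coeffs linear_add[OF orth_proj_linear])
        (simp add: synth_def scaleR_add_left sum.distrib flip: synth_proj_coeffs)
    from synth_inj[OF this True]
    show "proj_coeffs n \<phi> (u + v) i = proj_coeffs n \<phi> u i + proj_coeffs n \<phi> v i" .
  next
    fix c u
    have "synth n \<phi> (proj_coeffs n \<phi> (c *\<^sub>R u)) = synth n \<phi> (\<lambda>i. c * proj_coeffs n \<phi> u i)"
      by (simp add: synth_proj_coeffs linear_scale[OF orth_proj_linear])
        (simp add: synth_def scaleR_sum_right flip: synth_proj_coeffs)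
    from synth_inj[OF this True]
    show "proj_coeffs n \<phi> (c *\<^sub>R u) i = c *\<^sub>R proj_coeffs n \<phi> u i"
      by simp
  qed
qed (simp add: proj_coeffs_eq_0 linear_zero)

lemma inner_synth: "inner (synth n \<phi> x) (synth n \<phi> z) = inner_M n \<phi> x z"
  unfolding synth_def inner_M_def gram_def inner_sum_left
  by (intro sum.cong refl) (simp add: inner_sum_right sum_distrib_left mult_ac)

lemma norm_synth: "norm (synth n \<phi> x) = norm_M n \<phi> x"
  by (simp add: norm_M_def norm_eq_sqrt_inner inner_synth)

lemma inner_basis_synth: "inner (\<phi> i) (synth n \<phi> x) = (\<Sum>k<n. gram \<phi> i k * x k)"
  by (simp add: synth_def gram_def inner_sum_right mult.commute)

text \<open>The residual of \<open>\<phi> k\<close> after projection onto the span of the other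
  basis vectors is orthogonal to those, nonzero by independence, and has inner product |r|^2 with
  \<open>\<phi> k\<close>; dividing by |r|^2 gives the dual vector. These vectors supply the inverse
  Gram matrix and show that the coefficient functionals are bounded.\<close>

lemma dual_basis_exists:
  assumes k: "k < n"
  shows "\<exists>p\<in>V. \<forall>i<n. inner (\<phi> i) p = (if i = k then 1 else 0)"
proof -
  let ?B = "\<phi> ` ({..<n} - {k})"
  obtain E where E: "orthonormal_set E" "span E = span ?B"
    using orthonormal_set_exists[of ?B] by auto
  define r where "r = \<phi> k - (\<Sum>e\<in>E. inner (\<phi> k) e *\<^sub>R e)"
  have s: "(\<Sum>e\<in>E. inner (\<phi> k) e *\<^sub>R e) \<in> span ?B"
    using orthonormal_set_sum_in_span[of _ E] E(2) by auto
  have orth: "inner r v = 0" if "v \<in> span ?B" for v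
    unfolding r_def by (rule orthonormal_set_residual[OF E(1)]) (use E that in simp)
  have "\<phi> k \<notin> span ?B"
  proof -
    have "?B = \<phi> ` {..<n} - {\<phi> k}"
      using basis k by (auto simp: basis_family_def inj_on_def)
    then show ?thesis
      using basis k by (auto simp: basis_family_def dependent_def)
  qed
  with s have r: "r \<noteq> 0" by (auto simp: r_def)
  have rk: "inner (\<phi> k) r = (norm r)\<^sup>2"
    using orth[OF s] by (simp add: r_def power2_norm_eq_inner inner_diff_left inner_diff_right
        inner_commute)
  have ri: "inner (\<phi> i) r = 0" if "i < n" "i \<noteq> k" for i
    using orth[of "\<phi> i"] that by (simp add: span_base inner_commute)
  have "r \<in> V"
    unfolding r_def
    using s span_mono[of ?B "\<phi> ` {..<n}"] by (intro span_diff basis_in_V k) auto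
  then have "r /\<^sub>R (norm r)\<^sup>2 \<in> V"
    by (rule span_scale)
  then show ?thesis
    by (rule bexI[rotated]) (use r rk ri in auto)
qed

text \<open>\<open>mat_inv\<close> is a definite description, so existence and uniqueness are both
  due. The coefficients of the dual basis are the columns of an inverse. The difference of two
  candidate columns synthesises to a vector orthogonal to every basis vector, hence to
  itself.\<close>

lemma gram_inverse: "i < n \<Longrightarrow> k < n \<Longrightarrow>
  (\<Sum>l<n. gram \<phi> i l * mat_inv n (gram \<phi>) l k) = (if i = k then 1 else 0)"
proof -
  let ?P = "\<lambda>B :: nat \<Rightarrow> nat \<Rightarrow> real. (\<forall>i k. n \<le> i \<or> n \<le> k \<longrightarrow> B i k = 0) \<and>
     (\<forall>i<n. \<forall>k<n. (\<Sum>l<n. gram \<phi> i l * B l k) = (if i = k then 1 else 0))"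
  have "\<exists>!B. ?P B"
  proof (rule ex_ex1I)
    have "\<forall>k. \<exists>x. k < n \<longrightarrow> (\<forall>i\<ge>n. x i = 0) \<and>
        (\<forall>i<n. inner (\<phi> i) (synth n \<phi> x) = (if i = k then 1 else 0))"
      using dual_basis_exists synth_surj by metis
    then obtain x where x: "\<And>k. k < n \<Longrightarrow> (\<forall>i\<ge>n. x k i = 0) \<and>
        (\<forall>i<n. inner (\<phi> i) (synth n \<phi> (x k)) = (if i = k then 1 else 0))"
      by metis
    show "\<exists>B. ?P B"
      by (rule exI[of _ "\<lambda>i k. if k < n then x k i else 0"])
        (use x in \<open>auto simp: inner_basis_synth\<close>)
  next
    fix B B'
    assume B: "?P B" and B': "?P B'"
    have "B i k = B' i k" if i: "i < n" and k: "k < n" for i k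
    proof -
      let ?d = "synth n \<phi> (\<lambda>l. B l k - B' l k)"
      have 0: "inner (\<phi> i) ?d = 0" if "i < n" for i
        using B B' that k
        by (simp add: inner_basis_synth right_diff_distrib sum_subtractf)
      have "inner ?d ?d = 0"
        using 0 by (subst (1) synth_def) (simp add: inner_sum_left)
      then show ?thesis
        using synth_eq_0[of "\<lambda>l. B l k - B' l k" i] i by simp
    qed
    then show "B = B'"
      using B B' by (intro ext) (metis not_less)
  qed
  from theI'[OF this] show "i < n \<Longrightarrow> k < n \<Longrightarrow> ?thesis"
    unfolding mat_inv_def by blast
qed

lemma inner_basis_fwd_adj:
  assumes "i < n"
  shows "inner (\<phi> i) (synth n \<phi> (fwd_adj n \<phi> F w)) = inner (F i) w"
proof -
  have "inner (\<phi> i) (synth n \<phi> (fwd_adj n \<phi> F w)) =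
      (\<Sum>l<n. \<Sum>k<n. (gram \<phi> i l * mat_inv n (gram \<phi>) l k) * inner (F k) w)"
    by (simp add: inner_basis_synth fwd_adj_def mat_vec_def sum_distrib_left mult.assoc)
  also have "\<dots> = (\<Sum>k<n. (\<Sum>l<n. gram \<phi> i l * mat_inv n (gram \<phi>) l k) * inner (F k) w)"
    by (subst sum.swap) (simp add: sum_distrib_right)
  also have "\<dots> = (\<Sum>k<n. if i = k then inner (F k) w else 0)"
    by (rule sum.cong) (simp_all add: gram_inverse assms)
  also have "\<dots> = inner (F i) w"
    using assms by simp
  finally show ?thesis .
qed

text \<open>Replacing \<open>h\<close> by its projection leaves inner products with the subspace
  unchanged, and against each basis vector the Gram matrix cancels its inverse inside
  \<open>fwd_adj\<close>.\<close>

lemma inner_fwd_proj_coeffs: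
  "inner (fwd n F (proj_coeffs n \<phi> h)) w = inner h (synth n \<phi> (fwd_adj n \<phi> F w))"
proof -
  have "inner h (synth n \<phi> (fwd_adj n \<phi> F w)) =
      inner (synth n \<phi> (proj_coeffs n \<phi> h)) (synth n \<phi> (fwd_adj n \<phi> F w))"
    using inner_orth_proj[OF synth_in_V, of "fwd_adj n \<phi> F w" h]
    by (simp add: synth_proj_coeffs inner_commute)
  also have "\<dots> = (\<Sum>i<n. proj_coeffs n \<phi> h i * inner (\<phi> i) (synth n \<phi> (fwd_adj n \<phi> F w)))"
    by (subst (1) synth_def) (simp add: inner_sum_left)
  also have "\<dots> = inner (fwd n F (proj_coeffs n \<phi> h)) w"
    by (simp add: inner_basis_fwd_adj fwd_def inner_sum_left)
  finally show ?thesis ..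
qed

lemma fwd_proj_coeffs_synth: "fwd n F (proj_coeffs n \<phi> (synth n \<phi> x)) = fwd n F x"
  unfolding fwd_def by (rule sum.cong) (auto simp: proj_coeffs_synth)

lemma fwd_proj_coeffs_linear: "linear (\<lambda>h. fwd n F (proj_coeffs n \<phi> h))"
  unfolding fwd_def
  by (rule linearI)
    (simp_all add: linear_add[OF proj_coeffs_linear] linear_scale[OF proj_coeffs_linear]
      scaleR_add_left sum.distrib scaleR_sum_right)

lemma mat_vec_proj_coeffs_synth: "mat_vec n A (proj_coeffs n \<phi> (synth n \<phi> x)) = mat_vec n A x"
  unfolding mat_vec_def by (intro ext sum.cong) (auto simp: proj_coeffs_synth)

end

section \<open>The Kalman gain\<close>

text \<open>The bound is the minimum of the quadratic form on the compact unit sphere, extended by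
  homogeneity.\<close>

lemma pos_def_matrix_lower_bound:
  fixes \<Gamma> :: "real^'d^'d"
  assumes "pos_def_matrix \<Gamma>"
  obtains \<gamma> where "0 < \<gamma>" "\<And>w. \<gamma> * (norm w)\<^sup>2 \<le> inner w (\<Gamma> *v w)"
proof -
  have "\<exists>x\<in>sphere 0 1. \<forall>w\<in>sphere 0 1. inner x (\<Gamma> *v x) \<le> inner w (\<Gamma> *v w)"
    by (rule continuous_attains_inf)
      (auto intro!: continuous_intros matrix_vector_mult_linear_continuous_on)
  then obtain x where x: "norm x = 1"
    and min: "\<And>w. norm w = 1 \<Longrightarrow> inner x (\<Gamma> *v x) \<le> inner w (\<Gamma> *v w)"
    by auto
  show thesis
  proof (rule that)
    show "0 < inner x (\<Gamma> *v x)"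
      using assms x unfolding pos_def_matrix_def by (metis norm_zero zero_neq_one)
    fix w
    show "inner x (\<Gamma> *v x) * (norm w)\<^sup>2 \<le> inner w (\<Gamma> *v w)"
    proof (cases "w = 0")
      case False
      then have "inner x (\<Gamma> *v x) \<le> inner (w /\<^sub>R norm w) (\<Gamma> *v (w /\<^sub>R norm w))"
        by (intro min) simp
      also have "\<dots> = inner w (\<Gamma> *v w) / (norm w)\<^sup>2"
        by (simp add: matrix_vector_mult_scaleR power2_eq_square divide_simps)
      finally show ?thesis
        using False by (simp add: field_simps)
    qed simp
  qed
qed

definition innovation_matrix ::
  "('h::real_inner \<Rightarrow> 'h) \<Rightarrow> ('h \<Rightarrow> real^'d) \<Rightarrow> (real^'d \<Rightarrow> 'h) \<Rightarrow> real^'d^'d \<Rightarrow> real^'d^'d" where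
  "innovation_matrix A G G' \<Gamma> = matrix (\<lambda>z. G (A (G' z))) + \<Gamma>"

definition gain ::
  "('h::real_inner \<Rightarrow> 'h) \<Rightarrow> ('h \<Rightarrow> real^'d) \<Rightarrow> (real^'d \<Rightarrow> 'h) \<Rightarrow> real^'d^'d \<Rightarrow> real^'d \<Rightarrow> 'h" where
  "gain A G G' \<Gamma> w = A (G' (matrix_inv (innovation_matrix A G G' \<Gamma>) *v w))"

lemma posterior_mean_eq_gain:
  "posterior_mean Fc \<Gamma> Cc m0 y = m0 + gain Cc Fc (adjoint Fc) \<Gamma> (y - Fc m0)"
  by (simp add: posterior_mean_def gain_def innovation_matrix_def)

lemma gain_linear: "linear A \<Longrightarrow> linear G' \<Longrightarrow> linear (gain A G G' \<Gamma>)"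
  using linear_compose[OF linear_compose[OF matrix_vector_mul_linear], of G' A]
  by (simp add: gain_def[abs_def] o_def)

lemma innovation_matrix_mult:
  assumes "linear A" "linear G" "linear G'"
  shows "innovation_matrix A G G' \<Gamma> *v w = G (A (G' w)) + \<Gamma> *v w"
proof -
  have "linear (\<lambda>z. G (A (G' z)))"
    using linear_compose[OF linear_compose[OF assms(3,1)] assms(2)] by (simp add: o_def)
  then have "matrix (\<lambda>z. G (A (G' z))) *v w = G (A (G' w))"
    by (metis matrix_vector_mul(2))
  then show ?thesis
    by (simp add: innovation_matrix_def matrix_vector_mult_add_rdistrib)
qed

locale noise_lower_bound =
  fixes \<Gamma> :: "real^'d^'d" and \<gamma> :: real
  assumes \<gamma>: "0 < \<gamma>" "\<And>w. \<gamma> * (norm w)\<^sup>2 \<le> inner w (\<Gamma> *v w)"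
begin

context
  fixes A :: "'h::real_inner \<Rightarrow> 'h" and G :: "'h \<Rightarrow> real^'d" and G'
  assumes A: "linear A" "\<And>h. 0 \<le> inner (A h) h"
    and G: "linear G" "\<And>h w. inner (G h) w = inner h (G' w)"
begin

text \<open>The forward covariance contributes <A G'w, G'w> >= 0, so the quadratic form of the
  innovation matrix is at least that of \<open>\<Gamma>\<close>. The resulting bound on the inverse
  is the same for every nonnegative \<open>A\<close>, hence for every realisation of the sample
  covariance.\<close>

lemma innovation_matrix_coercive:
  "\<gamma> * norm w \<le> norm (innovation_matrix A G G' \<Gamma> *v w)"
proof (cases "w = 0")
  case False
  have "\<gamma> * (norm w)\<^sup>2 \<le> inner (A (G' w)) (G' w) + inner w (\<Gamma> *v w)"
    using \<gamma>(2)[of w] A(2)[of "G' w"] by simp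
  also have "\<dots> = inner w (innovation_matrix A G G' \<Gamma> *v w)"
    by (simp add: innovation_matrix_mult A G adjoint_pair_linear[OF G(2)] inner_add_right
        flip: G(2)) (simp add: inner_commute)
  also have "\<dots> \<le> norm w * norm (innovation_matrix A G G' \<Gamma> *v w)"
    by (rule norm_cauchy_schwarz)
  finally show ?thesis
    using False by (simp add: power2_eq_square)
qed simp

lemma innovation_matrix_invertible: "invertible (innovation_matrix A G G' \<Gamma>)"
  unfolding invertible_left_inverse matrix_left_invertible_ker
  using innovation_matrix_coercive \<gamma>(1)
  by (metis mult_le_0_iff norm_le_zero_iff norm_zero not_less)

lemma innovation_matrix_inv:
  "innovation_matrix A G G' \<Gamma> *v (matrix_inv (innovation_matrix A G G' \<Gamma>) *v w) = w"
proof -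
  let ?S = "innovation_matrix A G G' \<Gamma>"
  have "?S ** matrix_inv ?S = mat 1"
    using someI_ex[OF innovation_matrix_invertible[unfolded invertible_def]]
    by (simp add: matrix_inv_def)
  then show ?thesis
    by (simp add: matrix_vector_mul_assoc)
qed

lemma norm_innovation_matrix_inv_le:
  "norm (matrix_inv (innovation_matrix A G G' \<Gamma>) *v w) \<le> norm w / \<gamma>"
  using innovation_matrix_coercive[of "matrix_inv (innovation_matrix A G G' \<Gamma>) *v w"] \<gamma>(1)
  by (simp add: innovation_matrix_inv field_simps)

lemma norm_gain_le:
  assumes "\<And>h. norm (A h) \<le> a * norm h" "\<And>w. norm (G' w) \<le> g * norm w" "0 \<le> a" "0 \<le> g"
  shows "norm (gain A G G' \<Gamma> w) \<le> a * g / \<gamma> * norm w"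
proof -
  have "norm (gain A G G' \<Gamma> w) \<le>
      a * (g * norm (matrix_inv (innovation_matrix A G G' \<Gamma>) *v w))"
    unfolding gain_def by (intro order_trans[OF assms(1)] mult_left_mono assms)
  also have "\<dots> \<le> a * (g * (norm w / \<gamma>))"
    by (intro mult_left_mono norm_innovation_matrix_inv_le assms)
  finally show ?thesis by simp
qed

end

text \<open>The difference of the gains is affine in \<open>d\<close>: the resolvent identity is arranged so that
  the perturbed covariance \<open>B\<close> enters only through \<open>B - A\<close>.\<close>

lemma norm_gain_diff_le:
  fixes A B :: "'h::real_inner \<Rightarrow> 'h" and F G :: "'h \<Rightarrow> real^'d"
  assumes A: "linear A" "\<And>h. 0 \<le> inner (A h) h"
    and B: "linear B" "\<And>h. 0 \<le> inner (B h) h"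
    and F: "linear F" "\<And>h w. inner (F h) w = inner h (F' w)"
    and G: "linear G" "\<And>h w. inner (G h) w = inner h (G' w)"
    and a: "\<And>h. norm (A h) \<le> a * norm h" "0 \<le> a"
    and d: "\<And>h. norm (B h - A h) \<le> d * norm h" "0 \<le> d"
    and g: "\<And>h. norm (F h) \<le> g * norm h" "\<And>h. norm (G h) \<le> g * norm h" "0 \<le> g"
    and \<delta>: "\<And>h. norm (F h - G h) \<le> \<delta> * norm h" "0 \<le> \<delta>"
  shows "norm (gain A F F' \<Gamma> w - gain B G G' \<Gamma> w) \<le>
    ((g / \<gamma> + a * g * g\<^sup>2 / \<gamma>\<^sup>2) * d + (a / \<gamma> + 2 * a * g * (a * g) / \<gamma>\<^sup>2) * \<delta>) * norm w"
proof -
  define SA where "SA = innovation_matrix A F F' \<Gamma>"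
  define SB where "SB = innovation_matrix B G G' \<Gamma>"
  define z where "z = matrix_inv SA *v w"
  define v where "v = matrix_inv SB *v w"
  have F': "linear F'" and G': "linear G'"
    using adjoint_pair_linear F(2) G(2) by blast+
  have F'_le: "norm (F' u) \<le> g * norm u" and G'_le: "norm (G' u) \<le> g * norm u" for u
    using adjoint_pair_norm_le[OF F(2) g(1,3)] adjoint_pair_norm_le[OF G(2) g(2,3)] by auto
  \<comment> \<open>The adjoint of F - G is F' - G', so the forward-model error bound passes to the
    adjoints with the same constant.\<close>
  have FG'_le: "norm (F' u - G' u) \<le> \<delta> * norm u" for u
    by (rule adjoint_pair_norm_le[where G = "\<lambda>h. F h - G h"])
      (use \<delta> in \<open>auto simp: F(2) G(2) inner_diff_left inner_diff_right\<close>)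
  have v_le: "norm v \<le> norm w / \<gamma>"
    unfolding v_def SB_def by (rule norm_innovation_matrix_inv_le[OF B G])
  have BA: "norm (B (G' v) - A (F' v)) \<le> (d * g + a * \<delta>) * norm v"
  proof -
    have "B (G' v) - A (F' v) = (B (G' v) - A (G' v)) - A (F' v - G' v)"
      by (simp add: linear_diff[OF A(1)])
    also have "norm \<dots> \<le> d * norm (G' v) + a * norm (F' v - G' v)"
      by (intro order_trans[OF norm_triangle_ineq4] add_mono d a)
    also have "\<dots> \<le> d * (g * norm v) + a * (\<delta> * norm v)"
      by (intro add_mono mult_left_mono G'_le FG'_le d a)
    finally show ?thesis by (simp add: algebra_simps)
  qed
  have "SA *v (z - v) = G (B (G' v)) - F (A (F' v))"
  proof -
    have "SA *v z = w" "SB *v v = w"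
      unfolding z_def v_def SA_def SB_def
      by (rule innovation_matrix_inv[OF A F], rule innovation_matrix_inv[OF B G])
    then have "SA *v (z - v) = SB *v v - SA *v v"
      by (simp add: matrix_vector_mult_diff_distrib)
    then show ?thesis
      by (simp add: SA_def SB_def innovation_matrix_mult A B F G F' G')
  qed
  also have "\<dots> = G (B (G' v) - A (F' v)) - (F (A (F' v)) - G (A (F' v)))"
    by (simp add: linear_diff[OF G(1)])
  also have "norm \<dots> \<le> g * norm (B (G' v) - A (F' v)) + \<delta> * norm (A (F' v))"
    by (intro order_trans[OF norm_triangle_ineq4] add_mono g \<delta>)
  also have "\<dots> \<le> g * ((d * g + a * \<delta>) * norm v) + \<delta> * (a * (g * norm v))"
    by (intro add_mono mult_left_mono BA order_trans[OF a(1)] F'_le g \<delta> a)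
  finally have "norm (SA *v (z - v)) \<le> (g * (d * g + a * \<delta>) + \<delta> * a * g) * norm v"
    by (simp add: algebra_simps)
  with innovation_matrix_coercive[OF A F, of "z - v"]
  have "\<gamma> * norm (z - v) \<le> (g * (d * g + a * \<delta>) + \<delta> * a * g) * norm v"
    by (simp add: SA_def)
  then have zv: "norm (z - v) \<le> (g * (d * g + a * \<delta>) + \<delta> * a * g) / \<gamma> * norm v"
    using \<gamma>(1) by (simp add: field_simps)
  have "gain A F F' \<Gamma> w - gain B G G' \<Gamma> w = A (F' (z - v)) - (B (G' v) - A (F' v))"
    by (simp add: gain_def z_def v_def SA_def SB_def linear_diff[OF A(1)] linear_diff[OF F'])
  also have "norm \<dots> \<le> a * (g * norm (z - v)) + (d * g + a * \<delta>) * norm v"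
    by (intro order_trans[OF norm_triangle_ineq4] add_mono BA order_trans[OF a(1)]
        mult_left_mono F'_le a)
  also have "\<dots> \<le> a * (g * ((g * (d * g + a * \<delta>) + \<delta> * a * g) / \<gamma> * norm v))
      + (d * g + a * \<delta>) * norm v"
    by (intro add_mono mult_left_mono zv a g order_refl)
  also have "\<dots> = (a * g * (g * (d * g + a * \<delta>) + \<delta> * a * g) / \<gamma> + (d * g + a * \<delta>)) * norm v"
    by (simp add: algebra_simps)
  also have "\<dots> \<le> (a * g * (g * (d * g + a * \<delta>) + \<delta> * a * g) / \<gamma> + (d * g + a * \<delta>))
      * (norm w / \<gamma>)"
    using a d g \<delta> \<gamma>(1) by (intro mult_left_mono v_le) auto
  also have "\<dots> = ((g / \<gamma> + a * g * g\<^sup>2 / \<gamma>\<^sup>2) * d + (a / \<gamma> + 2 * a * g * (a * g) / \<gamma>\<^sup>2) * \<delta>)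
      * norm w"
    by (simp add: divide_inverse power2_eq_square algebra_simps)
  finally show ?thesis .
qed

end

section \<open>Kalman update in the Hilbert space\<close>

definition sample_mean :: "nat \<Rightarrow> (nat \<Rightarrow> 'a::real_vector) \<Rightarrow> 'a" where
  "sample_mean J w = (1 / real J) *\<^sub>R (\<Sum>j<J. w j)"

definition sample_cov :: "nat \<Rightarrow> (nat \<Rightarrow> 'h::real_inner) \<Rightarrow> 'h \<Rightarrow> 'h" where
  "sample_cov J w h = (1 / (real J - 1)) *\<^sub>R
     (\<Sum>j<J. inner (w j - sample_mean J w) h *\<^sub>R (w j - sample_mean J w))"

lemma sample_cov_linear: "linear (sample_cov J w)"
  unfolding sample_cov_def
  by (rule linearI) (simp_all add: inner_add_right scaleR_add_left sum.distrib scaleR_add_right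
      scaleR_sum_right mult_ac)

lemma sample_mean_diff: "0 < J \<Longrightarrow> sample_mean J (\<lambda>j. w j - b) = sample_mean J w - b"
  by (simp add: sample_mean_def sum_subtractf scaleR_diff_right sum_constant_scaleR)

text \<open>This permits the ensemble to be centred at its exact mean before any moment is
  computed.\<close>

lemma sample_cov_shift: "0 < J \<Longrightarrow> sample_cov J (\<lambda>j. w j - b) = sample_cov J w"
  by (simp add: sample_cov_def fun_eq_iff sample_mean_diff)

lemma inner_sample_cov:
  "inner (sample_cov J w h) k = (1 / (real J - 1)) *
     (\<Sum>j<J. inner (w j - sample_mean J w) h * inner (w j - sample_mean J w) k)"
  by (simp add: sample_cov_def inner_sum_left)

lemma sample_cov_nonneg: "1 \<le> J \<Longrightarrow> 0 \<le> inner (sample_cov J w h) h"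
  by (auto simp: inner_sample_cov power2_eq_square[symmetric]
      intro!: divide_nonneg_nonneg sum_nonneg)

context finite_basis
begin

lemma synth_ens_mean: "synth n \<phi> (ens_mean J u) = sample_mean J (\<lambda>j. synth n \<phi> (u j))"
proof -
  have "synth n \<phi> (ens_mean J u) = (\<Sum>i<n. \<Sum>j<J. (1 / real J) *\<^sub>R (u j i *\<^sub>R \<phi> i))"
    by (simp add: synth_def ens_mean_def sum_divide_distrib scaleR_sum_left)
  also have "\<dots> = sample_mean J (\<lambda>j. synth n \<phi> (u j))"
    by (subst sum.swap) (simp add: sample_mean_def synth_def scaleR_sum_right)
  finally show ?thesis .
qed

text \<open>The Gram factor on the right of the sample covariance matrix is what turns its
  coordinate products into inner products of the Hilbert space.\<close>

lemma synth_mat_vec_ens_cov: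
  "synth n \<phi> (mat_vec n (ens_cov n \<phi> J u) x) =
     sample_cov J (\<lambda>j. synth n \<phi> (u j)) (synth n \<phi> x)"
proof -
  let ?m = "ens_mean J u"
  define d where "d j = (\<lambda>i. u j i - ?m i)" for j
  have d: "synth n \<phi> (d j) = synth n \<phi> (u j) - sample_mean J (\<lambda>j. synth n \<phi> (u j))" for j
    by (simp add: d_def synth_diff synth_ens_mean)
  have "mat_vec n (ens_cov n \<phi> J u) x i =
      (1 / (real J - 1)) * (\<Sum>j<J. inner (synth n \<phi> (d j)) (synth n \<phi> x) * d j i)" for i
  proof -
    have "mat_vec n (ens_cov n \<phi> J u) x i =
        (\<Sum>k<n. \<Sum>j<J. (1 / (real J - 1)) * (d j i * (\<Sum>l<n. d j l * gram \<phi> l k * x k)))"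
      by (simp add: mat_vec_def ens_cov_def d_def sum_divide_distrib sum_distrib_right
          sum_distrib_left mult_ac)
    also have "\<dots> = (\<Sum>j<J. (1 / (real J - 1)) *
        (d j i * (\<Sum>k<n. \<Sum>l<n. d j l * gram \<phi> l k * x k)))"
      by (subst sum.swap) (simp add: sum_distrib_left)
    also have "\<dots> = (\<Sum>j<J. (1 / (real J - 1)) *
        (d j i * inner (synth n \<phi> (d j)) (synth n \<phi> x)))"
      unfolding inner_synth inner_M_def by (subst (2) sum.swap) simp
    finally show ?thesis
      by (simp add: sum_distrib_left mult_ac)
  qed
  then have "synth n \<phi> (mat_vec n (ens_cov n \<phi> J u) x) =
      (\<Sum>i<n. \<Sum>j<J. (1 / (real J - 1)) *\<^sub>R
         inner (synth n \<phi> (d j)) (synth n \<phi> x) *\<^sub>R d j i *\<^sub>R \<phi> i)"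
    by (simp add: synth_def sum_distrib_left scaleR_sum_left)
  also have "\<dots> = (1 / (real J - 1)) *\<^sub>R
      (\<Sum>j<J. inner (synth n \<phi> (d j)) (synth n \<phi> x) *\<^sub>R synth n \<phi> (d j))"
    by (subst sum.swap) (simp add: synth_def[of n \<phi> "d _"] scaleR_sum_right)
  finally show ?thesis
    by (simp add: d sample_cov_def)
qed

text \<open>All members share one gain, which is linear, so averaging passes through it. The
  posterior ensemble mean thus depends on the draws only through three statistics: the ensemble
  mean, the sample covariance and the noise mean.\<close>

lemma synth_enkf_mean:
  fixes F :: "nat \<Rightarrow> real^'d"
  defines "G \<equiv> \<lambda>h. fwd n F (proj_coeffs n \<phi> h)"
    and "G' \<equiv> \<lambda>w. synth n \<phi> (fwd_adj n \<phi> F w)"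
  assumes J: "0 < J"
  shows "synth n \<phi> (enkf_mean n \<phi> F \<Gamma> y J u \<eta>) =
    sample_mean J (\<lambda>j. synth n \<phi> (u j)) +
    gain (sample_cov J (\<lambda>j. synth n \<phi> (u j))) G G' \<Gamma>
      (y - G (sample_mean J (\<lambda>j. synth n \<phi> (u j))) + sample_mean J \<eta>)"
proof -
  let ?U = "\<lambda>j. synth n \<phi> (u j)"
  let ?K = "gain (sample_cov J ?U) G G' \<Gamma>"
  have adj: "inner (G h) w = inner h (G' w)" for h w
    unfolding G_def G'_def by (rule inner_fwd_proj_coeffs)
  have K: "linear ?K"
    by (intro gain_linear sample_cov_linear adjoint_pair_linear[OF adj])
  have G: "linear G"
    unfolding G_def by (rule fwd_proj_coeffs_linear)
  have gain: "synth n \<phi> (kalman_gain n \<phi> F \<Gamma> (ens_cov n \<phi> J u) w) = ?K w" for w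
  proof -
    have "fwd n F (mat_vec n (ens_cov n \<phi> J u) (fwd_adj n \<phi> F z)) = G (sample_cov J ?U (G' z))"
      for z
      by (simp add: G_def G'_def fwd_proj_coeffs_synth flip: synth_mat_vec_ens_cov)
    then show ?thesis
      by (simp add: kalman_gain_def gain_def innovation_matrix_def synth_mat_vec_ens_cov G'_def)
  qed
  have upd: "synth n \<phi> (enkf_update n \<phi> F \<Gamma> y J u \<eta> j) = ?U j + ?K (y - G (?U j) + \<eta> j)" for j
  proof -
    have "synth n \<phi> (enkf_update n \<phi> F \<Gamma> y J u \<eta> j) =
        ?U j + synth n \<phi> (kalman_gain n \<phi> F \<Gamma> (ens_cov n \<phi> J u) (y - fwd n F (u j) + \<eta> j))"
      by (simp add: synth_def enkf_update_def scaleR_add_left sum.distrib)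
    then show ?thesis
      by (simp add: gain G_def fwd_proj_coeffs_synth)
  qed
  have "sample_mean J (\<lambda>j. ?K (y - G (?U j) + \<eta> j)) =
      ?K (sample_mean J (\<lambda>j. y - G (?U j) + \<eta> j))"
    by (simp add: sample_mean_def linear_sum[OF K] linear_scale[OF K])
  also have "sample_mean J (\<lambda>j. y - G (?U j) + \<eta> j) = y - G (sample_mean J ?U) + sample_mean J \<eta>"
    using J by (simp add: sample_mean_def linear_sum[OF G] linear_scale[OF G] sum.distrib
        sum_subtractf scaleR_add_right scaleR_diff_right sum_constant_scaleR
        del: sum_constant)
  finally have "sample_mean J (\<lambda>j. ?K (y - G (?U j) + \<eta> j)) =
      ?K (y - G (sample_mean J ?U) + sample_mean J \<eta>)" .
  moreover have "synth n \<phi> (enkf_mean n \<phi> F \<Gamma> y J u \<eta>) =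
      sample_mean J ?U + sample_mean J (\<lambda>j. ?K (y - G (?U j) + \<eta> j))"
    unfolding enkf_mean_def synth_ens_mean upd
    by (simp add: sample_mean_def sum.distrib scaleR_add_right)
  ultimately show ?thesis by simp
qed

end

section \<open>Sample covariances\<close>

text \<open>The bilinear form of the sum of a_l (x) a_l. It is applied both to the ensemble, without
  centring or division, and to the columns of a square root of the covariance, so that sample and
  target are compared through one formula.\<close>

definition cov_form :: "'i set \<Rightarrow> ('i \<Rightarrow> 'h::real_inner) \<Rightarrow> 'h \<Rightarrow> 'h \<Rightarrow> real" where
  "cov_form I a h k = (\<Sum>l\<in>I. inner (a l) h * inner (a l) k)"

lemma cov_form_expansion:
  assumes E: "orthonormal_set E" and a: "\<And>l. l \<in> I \<Longrightarrow> a l \<in> span E"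
  shows "cov_form I a h k = (\<Sum>e\<in>E. \<Sum>f\<in>E. (inner h e * inner k f) * cov_form I a e f)"
proof -
  have "cov_form I a h k =
      (\<Sum>l\<in>I. (\<Sum>e\<in>E. inner h e * inner (a l) e) * (\<Sum>f\<in>E. inner k f * inner (a l) f))"
    unfolding cov_form_def
    by (intro sum.cong refl arg_cong2[where f = "(*)"])
      (simp_all add: parseval_orthonormal_set[OF E a] inner_commute[of "a _" h]
        inner_commute[of "a _" k])
  also have "\<dots> = (\<Sum>l\<in>I. \<Sum>e\<in>E. \<Sum>f\<in>E. (inner h e * inner k f) * (inner (a l) e * inner (a l) f))"
    by (simp add: sum_product mult_ac)
  also have "\<dots> = (\<Sum>e\<in>E. \<Sum>l\<in>I. \<Sum>f\<in>E. (inner h e * inner k f) * (inner (a l) e * inner (a l) f))"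
    by (rule sum.swap)
  also have "\<dots> = (\<Sum>e\<in>E. \<Sum>f\<in>E. \<Sum>l\<in>I. (inner h e * inner k f) * (inner (a l) e * inner (a l) f))"
    by (intro sum.cong refl sum.swap)
  finally show ?thesis
    by (simp add: cov_form_def sum_distrib_left)
qed

text \<open>Hilbert-Schmidt distance between the raw second moment and the target. The divisor is J,
  and no empirical mean is subtracted: for members centred at their exact mean, every entry is then
  an average of independent variables of mean zero.\<close>

definition cov_dev ::
  "'h::real_inner set \<Rightarrow> nat \<Rightarrow> (nat \<Rightarrow> 'h) \<Rightarrow> nat \<Rightarrow> (nat \<Rightarrow> 'h) \<Rightarrow> real" where
  "cov_dev E J w n a =
     sqrt (\<Sum>e\<in>E. \<Sum>f\<in>E. (cov_form {..<J} w e f / real J - cov_form {..<n} a e f)\<^sup>2)"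

lemma cov_dev_nonneg: "0 \<le> cov_dev E J w n a"
  by (simp add: cov_dev_def sum_nonneg)

text \<open>Cauchy-Schwarz over pairs of basis vectors. Since \<open>h\<close> and \<open>k\<close>
  range over the whole space and not only over the span of \<open>E\<close>, their coefficients are
  controlled by Bessel's inequality.\<close>

lemma cov_dev_bound:
  assumes E: "orthonormal_set E"
    and w: "\<And>j. j < J \<Longrightarrow> w j \<in> span E" and a: "\<And>l. l < n \<Longrightarrow> a l \<in> span E"
  shows "\<bar>cov_form {..<J} w h k / real J - cov_form {..<n} a h k\<bar>
    \<le> cov_dev E J w n a * norm h * norm k"
proof -
  define x where "x p = inner h (fst p) * inner k (snd p)" for p
  define z where "z p = cov_form {..<J} w (fst p) (snd p) / real J
    - cov_form {..<n} a (fst p) (snd p)" for p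
  let ?D = "cov_form {..<J} w h k / real J - cov_form {..<n} a h k"
  have "?D = (\<Sum>e\<in>E. \<Sum>f\<in>E. x (e, f) * z (e, f))"
    by (subst (1 2) cov_form_expansion[OF E])
      (use w a in \<open>auto simp: x_def z_def sum_divide_distrib sum_subtractf right_diff_distrib\<close>)
  then have D: "?D = (\<Sum>p\<in>E \<times> E. x p * z p)"
    by (simp add: sum.cartesian_product)
  have "?D\<^sup>2 \<le> (\<Sum>p\<in>E \<times> E. (x p)\<^sup>2) * (\<Sum>p\<in>E \<times> E. (z p)\<^sup>2)"
    unfolding D by (rule Cauchy_Schwarz_ineq_sum)
  also have "\<dots> \<le> ((norm h)\<^sup>2 * (norm k)\<^sup>2) * (\<Sum>p\<in>E \<times> E. (z p)\<^sup>2)"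
  proof (intro mult_right_mono sum_nonneg)
    have "(\<Sum>p\<in>E \<times> E. (x p)\<^sup>2) = (\<Sum>e\<in>E. (inner h e)\<^sup>2) * (\<Sum>f\<in>E. (inner k f)\<^sup>2)"
      by (simp add: x_def sum_product sum.cartesian_product case_prod_beta power_mult_distrib)
    also have "\<dots> \<le> (norm h)\<^sup>2 * (norm k)\<^sup>2"
      by (intro mult_mono bessel_orthonormal_set E sum_nonneg) auto
    finally show "(\<Sum>p\<in>E \<times> E. (x p)\<^sup>2) \<le> (norm h)\<^sup>2 * (norm k)\<^sup>2" .
  qed simp
  also have "(\<Sum>p\<in>E \<times> E. (z p)\<^sup>2) = (cov_dev E J w n a)\<^sup>2"
    by (simp add: cov_dev_def z_def sum.cartesian_product case_prod_beta sum_nonneg)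
  finally have "\<bar>?D\<bar>\<^sup>2 \<le> (cov_dev E J w n a * norm h * norm k)\<^sup>2"
    by (simp add: power_mult_distrib mult_ac)
  then show ?thesis
    by (rule power2_le_imp_le) (simp add: cov_dev_nonneg)
qed

lemma norm_le_of_inner_le:
  fixes x :: "'h::real_inner"
  assumes "\<And>k. inner x k \<le> c * norm k" and "0 \<le> c"
  shows "norm x \<le> c"
proof (cases "x = 0")
  case True
  with assms(2) show ?thesis by simp
next
  case False
  have "(norm x)\<^sup>2 \<le> c * norm x"
    using assms(1)[of x] by (simp add: power2_norm_eq_inner)
  then show ?thesis
    using False by (simp add: power2_eq_square)
qed

lemma inner_sample_cov_eq:
  assumes "0 < J"
  shows "inner (sample_cov J w h) k = (1 / (real J - 1)) *
    (cov_form {..<J} w h k - real J * (inner (sample_mean J w) h * inner (sample_mean J w) k))"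
proof -
  let ?m = "sample_mean J w"
  have m: "(\<Sum>j<J. inner (w j) x) = real J * inner ?m x" for x
    using assms by (simp add: sample_mean_def inner_sum_left)
  have "(\<Sum>j<J. inner (w j - ?m) h * inner (w j - ?m) k) =
      cov_form {..<J} w h k - (\<Sum>j<J. inner (w j) h) * inner ?m k
      - inner ?m h * (\<Sum>j<J. inner (w j) k) + real J * (inner ?m h * inner ?m k)"
    by (simp add: cov_form_def inner_diff_left algebra_simps sum.distrib sum_subtractf
        sum_distrib_left)
  then show ?thesis
    by (simp add: inner_sample_cov m)
qed

context
  fixes E :: "'h::real_inner set" and J :: nat and w :: "nat \<Rightarrow> 'h" and n and a :: "nat \<Rightarrow> 'h"
    and T :: "'h \<Rightarrow> 'h" and \<kappa> :: real
  assumes E: "orthonormal_set E" and J: "2 \<le> J"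
    and w: "\<And>j. j < J \<Longrightarrow> w j \<in> span E" and a: "\<And>l. l < n \<Longrightarrow> a l \<in> span E"
    and T: "\<And>h k. inner (T h) k = cov_form {..<n} a h k"
    and \<kappa>: "\<And>h. norm (T h) \<le> \<kappa> * norm h" "0 \<le> \<kappa>"
begin

lemma cov_form_deviation:
  "\<bar>cov_form {..<J} w h k / real J - cov_form {..<n} a h k\<bar>
    \<le> cov_dev E J w n a * norm h * norm k"
  by (rule cov_dev_bound[OF E]) (use w a in auto)

lemma cov_form_target_le: "\<bar>cov_form {..<n} a h k\<bar> \<le> \<kappa> * norm h * norm k"
proof -
  have "\<bar>inner (T h) k\<bar> \<le> norm (T h) * norm k"
    by (rule Cauchy_Schwarz_ineq2)
  also have "\<dots> \<le> \<kappa> * norm h * norm k"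
    by (intro mult_right_mono \<kappa>) simp
  finally show ?thesis by (simp add: T)
qed

text \<open>Subtracting the empirical mean only decreases the diagonal of the form, and the factor 2
  is the bound on J/(J-1) for J >= 2.\<close>

lemma sample_cov_form_le:
  "inner (sample_cov J w h) h \<le> 2 * (\<kappa> + cov_dev E J w n a) * (norm h)\<^sup>2"
proof -
  let ?b = "(\<kappa> + cov_dev E J w n a) * (norm h)\<^sup>2"
  have b: "0 \<le> ?b"
    by (simp add: \<kappa> cov_dev_nonneg)
  have "cov_form {..<J} w h h / real J \<le> ?b"
    using cov_form_deviation[of h h] cov_form_target_le[of h h]
    by (simp add: power2_eq_square algebra_simps abs_le_iff)
  then have "cov_form {..<J} w h h \<le> real J * ?b"
    using J by (simp add: field_simps)
  then have "cov_form {..<J} w h h - real J * (inner (sample_mean J w) h * inner (sample_mean J w) h)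
      \<le> real J * ?b"
    by (smt (verit) mult_nonneg_nonneg of_nat_0_le_iff zero_le_square)
  then have "inner (sample_cov J w h) h \<le> (1 / (real J - 1)) * (real J * ?b)"
    using J by (subst inner_sample_cov_eq) (auto intro!: divide_right_mono)
  also have "\<dots> = (real J / (real J - 1)) * ?b"
    by simp
  also have "\<dots> \<le> 2 * ?b"
    using J b by (intro mult_right_mono) (auto simp: field_simps)
  finally show ?thesis by (simp only: mult.assoc)
qed

text \<open>Cauchy-Schwarz for a nonnegative form turns the diagonal bound into an operator bound.
  Unlike what \<open>norm_sample_cov_diff_le\<close> and the triangle inequality would give, it
  contains no square of the sample mean, so its product with one more random factor stays
  quadratic.\<close>

lemma norm_sample_cov_le:
  "norm (sample_cov J w h) \<le> 2 * (\<kappa> + cov_dev E J w n a) * norm h"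
proof -
  let ?c = "2 * (\<kappa> + cov_dev E J w n a)"
  let ?d = "\<lambda>j. w j - sample_mean J w"
  let ?r = "1 / (real J - 1)"
  have c: "0 \<le> ?c" by (simp add: \<kappa> cov_dev_nonneg)
  have r: "0 \<le> ?r" using J by simp
  have "inner (sample_cov J w h) k \<le> ?c * norm h * norm k" for k
  proof -
    have "(inner (sample_cov J w h) k)\<^sup>2 =
        ?r\<^sup>2 * (\<Sum>j<J. inner (?d j) h * inner (?d j) k)\<^sup>2"
      by (simp only: inner_sample_cov power_mult_distrib)
    also have "\<dots> \<le> ?r\<^sup>2 * ((\<Sum>j<J. (inner (?d j) h)\<^sup>2) * (\<Sum>j<J. (inner (?d j) k)\<^sup>2))"
      by (intro mult_left_mono Cauchy_Schwarz_ineq_sum) simp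
    also have "\<dots> = inner (sample_cov J w h) h * inner (sample_cov J w k) k"
      by (simp add: inner_sample_cov power2_eq_square)
    also have "\<dots> \<le> (?c * (norm h)\<^sup>2) * (?c * (norm k)\<^sup>2)"
      using J c by (intro mult_mono sample_cov_form_le sample_cov_nonneg) auto
    also have "\<dots> = (?c * norm h * norm k)\<^sup>2"
      by (simp add: power_mult_distrib power2_eq_square mult_ac)
    finally show ?thesis
      by (rule power2_le_imp_le) (use c in simp)
  qed
  then show ?thesis
    by (rule norm_le_of_inner_le) (use c in simp)
qed

text \<open>With q = J/(J-1) <= 2 and m the sample mean, the difference is q (raw second moment - T)
  + T/(J-1) - q m (x) m; the three terms of the bound correspond to these summands.\<close>

lemma norm_sample_cov_diff_le:
  "norm (sample_cov J w h - T h) \<le>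
    (2 * cov_dev E J w n a + \<kappa> / (real J - 1) + 2 * (norm (sample_mean J w))\<^sup>2) * norm h"
proof (rule norm_le_of_inner_le)
  fix k
  let ?m = "sample_mean J w"
  let ?D = "cov_form {..<J} w h k / real J - cov_form {..<n} a h k"
  let ?q = "real J / (real J - 1)"
  have q: "0 \<le> ?q" "?q \<le> 2" using J by (auto simp: field_simps)
  have "inner (sample_cov J w h - T h) k =
      ?q * ?D + cov_form {..<n} a h k / (real J - 1) - ?q * (inner ?m h * inner ?m k)"
  proof -
    define r where "r = real J - 1"
    define W where "W = cov_form {..<J} w h k / real J"
    have W: "cov_form {..<J} w h k = (r + 1) * W" and r: "r \<noteq> 0" and J': "real J = r + 1"
      using J by (auto simp: W_def r_def)
    have "(1 / r) * ((r + 1) * W - (r + 1) * m) - c =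
        ((r + 1) / r) * (W - c) + c / r - ((r + 1) / r) * m" for m c
      using r by (simp add: field_simps)
    then show ?thesis
      using J by (simp add: inner_diff_left T inner_sample_cov_eq W flip: r_def W_def J')
  qed
  also have "\<dots> \<le> 2 * (cov_dev E J w n a * norm h * norm k)
      + \<kappa> * norm h * norm k / (real J - 1) + 2 * ((norm ?m)\<^sup>2 * norm h * norm k)"
  proof -
    have "?q * ?D \<le> 2 * (cov_dev E J w n a * norm h * norm k)"
      using cov_form_deviation[of h k] q
      by (intro order_trans[OF mult_left_mono[of ?D "\<bar>?D\<bar>"] mult_mono]) auto
    moreover have "cov_form {..<n} a h k / (real J - 1) \<le> \<kappa> * norm h * norm k / (real J - 1)"
      using cov_form_target_le[of h k] J by (intro divide_right_mono) auto
    moreover have "- (?q * (inner ?m h * inner ?m k)) \<le> 2 * ((norm ?m)\<^sup>2 * norm h * norm k)"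
    proof -
      have "- (?q * (inner ?m h * inner ?m k)) \<le> ?q * (\<bar>inner ?m h\<bar> * \<bar>inner ?m k\<bar>)"
        using q by (metis abs_ge_minus_self abs_mult abs_of_nonneg)
      also have "\<dots> \<le> 2 * ((norm ?m * norm h) * (norm ?m * norm k))"
        by (intro mult_mono q Cauchy_Schwarz_ineq2) auto
      finally show ?thesis by (simp add: power2_eq_square mult_ac)
    qed
    ultimately show ?thesis by linarith
  qed
  finally show "inner (sample_cov J w h - T h) k \<le>
      (2 * cov_dev E J w n a + \<kappa> / (real J - 1) + 2 * (norm ?m)\<^sup>2) * norm h * norm k"
    by (simp add: algebra_simps)
qed (use J in \<open>auto intro!: mult_nonneg_nonneg add_nonneg_nonneg simp: \<kappa> cov_dev_nonneg\<close>)

end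

section \<open>The pathwise error bound\<close>

text \<open>A form of Young's inequality. If the mean square of t is of order 1/J, then for s = sqrt
  J both terms on the right have expectation of order 1/sqrt J. First moments are thus obtained from
  second moments while the estimate remains pathwise.\<close>

lemma le_scaled_square: "0 < s \<Longrightarrow> (t::real) \<le> s * t\<^sup>2 + 1 / s"
proof -
  assume s: "0 < s"
  have "0 \<le> s * (t - 1 / s)\<^sup>2 + s * t\<^sup>2 + 1 / s" using s by simp
  also have "s * (t - 1 / s)\<^sup>2 = s * t\<^sup>2 - 2 * t + 1 / s"
    using s by (simp add: power2_eq_square field_simps)
  finally show ?thesis by simp
qed

context noise_lower_bound
begin

text \<open>\<open>A\<close> stands for the exact covariance, \<open>T\<close> for its
  discretisation and \<open>B\<close> for the sample covariance; \<open>U\<close>, \<open>p\<close>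
  and \<open>e\<close> are the ensemble mean, its exact value and the noise mean. Sampling errors
  enter through \<open>X\<close>, \<open>D\<close> and \<open>norm e\<close> in linear and quadratic
  terms, each of which is dominated by the last factor of the bound.\<close>

lemma enkf_error_le:
  fixes A B T :: "'h::real_inner \<Rightarrow> 'h" and F G :: "'h \<Rightarrow> real^'d"
  assumes A: "linear A" "\<And>h. 0 \<le> inner (A h) h"
    and B: "linear B" "\<And>h. 0 \<le> inner (B h) h"
    and F: "linear F" "\<And>h w. inner (F h) w = inner h (F' w)"
    and G: "linear G" "\<And>h w. inner (G h) w = inner h (G' w)"
    and a: "\<And>h. norm (A h) \<le> a * norm h" "0 \<le> a"
    and g: "\<And>h. norm (F h) \<le> g * norm h" "\<And>h. norm (G h) \<le> g * norm h" "0 \<le> g"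
    and \<delta>: "\<And>h. norm (F h - G h) \<le> \<delta> * norm h" "0 \<le> \<delta>" "\<delta> \<le> \<Delta>"
    and TA: "\<And>h. norm (T h - A h) \<le> d * norm h" "0 \<le> d"
    and BT: "\<And>h. norm (B h - T h) \<le> (2 * D + \<kappa> / (real J - 1) + 2 * X\<^sup>2) * norm h"
    and B_le: "\<And>h. norm (B h) \<le> 2 * (\<kappa> + D) * norm h"
    and nonneg: "0 \<le> D" "0 \<le> \<kappa>" and J: "2 \<le> J"
    and Gp: "G p = G m0" and X: "X = norm (U - p)"
    and c1: "c1 = g / \<gamma> + a * g * g\<^sup>2 / \<gamma>\<^sup>2"
    and c2: "c2 = a / \<gamma> + 2 * a * g * (a * g) / \<gamma>\<^sup>2"
    and Y: "Y = norm (y - F m0)" and b: "b = g / \<gamma>"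
  shows "norm (m0 + gain A F F' \<Gamma> (y - F m0) - (U + gain B G G' \<Gamma> (y - G U + e))) \<le>
    norm (m0 - p) + (c1 * Y) * d + (c2 * Y + 2 * \<kappa> * b * norm m0) * \<delta> +
    (1 + c1 * Y * (4 + 2 * \<kappa>) + 2 * (\<kappa> + 1) * b * (g + 1) + 2 * b * norm m0 * \<Delta>) *
      (sqrt (real J) * (X\<^sup>2 + D\<^sup>2 + (norm e)\<^sup>2) + 1 / sqrt (real J))"
proof -
  let ?KA = "gain A F F' \<Gamma>" and ?KB = "gain B G G' \<Gamma>"
  let ?N = "norm e"
  define t where "t = 2 * D + \<kappa> / (real J - 1) + 2 * X\<^sup>2"
  define s where "s = sqrt (real J)"
  define R where "R = X\<^sup>2 + D\<^sup>2 + ?N\<^sup>2"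
  define Q where "Q = s * R + 1 / s"
  have s: "1 \<le> s" using J by (simp add: s_def)
  have sJ: "s\<^sup>2 = real J" by (simp add: s_def)
  have pos: "0 \<le> X" "0 \<le> Y" "0 \<le> b" "0 \<le> c1" "0 \<le> c2" "0 \<le> \<Delta>"
    using X Y b c1 c2 a g \<gamma>(1) \<delta> by (auto intro!: add_nonneg_nonneg)
  have t: "0 \<le> t" using nonneg J by (simp add: t_def)
  have tri: "norm (u - v + x + z) \<le> norm u + norm v + norm x + norm z" for u v x z :: 'h
    using norm_triangle_ineq[of "u - v + x" z] norm_triangle_ineq[of "u - v" x]
      norm_triangle_ineq4[of u v] by linarith
  have KB: "linear ?KB"
    by (intro gain_linear B adjoint_pair_linear[OF G(2)])
  \<comment> \<open>The discrete forward map does not distinguish \<open>m0\<close> from its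
    projection, so what remains beside the sampling error is the forward-model error at
    \<open>m0\<close>.\<close>
  have "G U - F m0 = G (U - p) - (F m0 - G m0)"
    by (simp add: linear_diff[OF G(1)] Gp)
  then have "norm (G U - F m0 - e) = norm (G (U - p) - (F m0 - G m0) - e)"
    by (simp only:)
  also have "\<dots> \<le> norm (G (U - p)) + norm (F m0 - G m0) + ?N"
    using norm_triangle_ineq4[of "G (U - p) - (F m0 - G m0)" e]
      norm_triangle_ineq4[of "G (U - p)" "F m0 - G m0"] by simp
  also have "\<dots> \<le> g * X + \<delta> * norm m0 + ?N"
    unfolding X by (intro add_mono g \<delta> order_refl)
  finally have arg: "norm (G U - F m0 - e) \<le> g * X + \<delta> * norm m0 + ?N" .
  \<comment> \<open>Both gains are compared on the deterministic vector \<open>y - F m0\<close>,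
    while the sample gain alone meets the fluctuation of the innovation. The X^2 inside the
    covariance error is thereby never multiplied by a further random factor.\<close>
  have "m0 + ?KA (y - F m0) - (U + ?KB (y - G U + e)) =
      (m0 - p) - (U - p) + (?KA (y - F m0) - ?KB (y - F m0)) + ?KB (G U - F m0 - e)"
  proof -
    have "y - G U + e = (y - F m0) - (G U - F m0 - e)"
      by simp
    then have "?KB (y - G U + e) = ?KB (y - F m0) - ?KB (G U - F m0 - e)"
      by (metis linear_diff[OF KB])
    then show ?thesis by simp
  qed
  note split = this
  have "norm (m0 - p - (U - p) + (?KA (y - F m0) - ?KB (y - F m0)) + ?KB (G U - F m0 - e))
      \<le> norm (m0 - p) + X + norm (?KA (y - F m0) - ?KB (y - F m0))
      + norm (?KB (G U - F m0 - e))"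
    unfolding X by (rule tri)
  note total = this
  have K_diff: "norm (?KA (y - F m0) - ?KB (y - F m0)) \<le> (c1 * (d + t) + c2 * \<delta>) * Y"
    unfolding c1 c2 Y
  proof (rule norm_gain_diff_le[OF A B F G a _ _ g \<delta>(1,2)])
    fix h
    have "norm (B h - A h) \<le> norm (B h - T h) + norm (T h - A h)"
      using norm_triangle_ineq[of "B h - T h" "T h - A h"] by simp
    also have "\<dots> \<le> t * norm h + d * norm h"
      unfolding t_def by (intro add_mono BT TA)
    finally show "norm (B h - A h) \<le> (d + t) * norm h"
      by (simp add: algebra_simps)
  qed (use t TA in simp)
  have K_arg: "norm (?KB (G U - F m0 - e)) \<le> 2 * (\<kappa> + D) * b * (g * X + \<delta> * norm m0 + ?N)"
  proof -
    have "norm (?KB (G U - F m0 - e)) \<le> 2 * (\<kappa> + D) * g / \<gamma> * norm (G U - F m0 - e)"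
      using nonneg g(3) adjoint_pair_norm_le[OF G(2) g(2,3)]
      by (intro norm_gain_le[OF B G B_le]) auto
    also have "\<dots> \<le> 2 * (\<kappa> + D) * g / \<gamma> * (g * X + \<delta> * norm m0 + ?N)"
      using nonneg g(3) \<gamma>(1) by (intro mult_left_mono arg) auto
    finally show ?thesis by (simp add: b)
  qed
  have 1: "norm (m0 + ?KA (y - F m0) - (U + ?KB (y - G U + e))) \<le>
      norm (m0 - p) + X + (c1 * (d + t) + c2 * \<delta>) * Y
      + 2 * (\<kappa> + D) * b * (g * X + \<delta> * norm m0 + ?N)"
    unfolding split using total K_diff K_arg by linarith
  have R: "0 \<le> R" "X\<^sup>2 \<le> R" "D\<^sup>2 \<le> R" "?N\<^sup>2 \<le> R" by (auto simp: R_def)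
  have lin: "r \<le> Q" if "r\<^sup>2 \<le> R" for r
  proof -
    have "r \<le> s * r\<^sup>2 + 1 / s" using s by (intro le_scaled_square) simp
    also have "\<dots> \<le> Q" unfolding Q_def using s that by (intro add_right_mono mult_left_mono) auto
    finally show ?thesis .
  qed
  \<comment> \<open>Here s >= 1 is used: quadratic terms are bounded by R, and R is absorbed by
    Q.\<close>
  have RQ: "R \<le> Q"
  proof -
    have "1 * R \<le> s * R" using s R by (intro mult_right_mono) auto
    then show ?thesis using s by (simp add: Q_def add_increasing2)
  qed
  have XQ: "X \<le> Q" and DQ: "D \<le> Q" and NQ: "?N \<le> Q"
    using lin R by auto
  have prod: "D * r \<le> Q" if "D\<^sup>2 + r\<^sup>2 \<le> R" for r
  proof -
    have "0 \<le> (D - r)\<^sup>2" by simp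
    then have "2 * (D * r) \<le> D\<^sup>2 + r\<^sup>2" by (simp add: power2_diff)
    with that RQ R show ?thesis by linarith
  qed
  have DX: "D * X \<le> Q" and DN: "D * ?N \<le> Q"
    by (intro prod; simp add: R_def)+
  \<comment> \<open>This treats the term T/(J-1) of the sample covariance: J <= 2 (J - 1) for J >=
    2, and 1/J <= 1/sqrt J.\<close>
  have JQ: "1 / (real J - 1) \<le> 2 * Q"
  proof -
    have "1 / (real J - 1) \<le> 2 / real J"
      using J by (simp add: field_simps)
    also have "\<dots> = 2 / (s * s)" by (simp add: sJ flip: power2_eq_square)
    also have "\<dots> \<le> 2 / s" using s by (intro divide_left_mono) auto
    also have "\<dots> \<le> 2 * Q" unfolding Q_def using R s by simp
    finally show ?thesis .
  qed
  have "\<kappa> * (1 / (real J - 1)) \<le> \<kappa> * (2 * Q)"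
    by (intro mult_left_mono JQ nonneg)
  then have tQ: "t \<le> (4 + 2 * \<kappa>) * Q"
    unfolding t_def using DQ R(2) RQ by (simp add: algebra_simps)
  have 2: "c1 * Y * t \<le> c1 * Y * ((4 + 2 * \<kappa>) * Q)"
    using pos by (intro mult_left_mono tQ) auto
  have 3: "2 * (\<kappa> + D) * b * (g * X + ?N) \<le> 2 * (\<kappa> + 1) * b * (g + 1) * Q"
  proof -
    have "(\<kappa> + D) * (g * X + ?N) = \<kappa> * (g * X + ?N) + (g * (D * X) + D * ?N)"
      by (simp add: algebra_simps)
    also have "\<dots> \<le> \<kappa> * (g * Q + Q) + (g * Q + Q)"
      by (intro add_mono mult_left_mono XQ NQ DX DN g nonneg)
    also have "\<dots> = (\<kappa> + 1) * (g + 1) * Q" by (simp add: algebra_simps)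
    finally have "2 * b * ((\<kappa> + D) * (g * X + ?N)) \<le> 2 * b * ((\<kappa> + 1) * (g + 1) * Q)"
      using pos by (intro mult_left_mono) auto
    then show ?thesis by (simp only: mult_ac)
  qed
  \<comment> \<open>The cross term between sampling and forward-model error is charged to the
    sampling error, with \<open>\<delta>\<close> replaced by its uniform bound
    \<open>\<Delta>\<close>.\<close>
  have 4: "2 * D * b * (\<delta> * norm m0) \<le> 2 * b * norm m0 * \<Delta> * Q"
  proof -
    have "D * \<delta> \<le> Q * \<Delta>"
      using DQ \<delta> nonneg pos by (intro mult_mono) auto
    then have "2 * b * norm m0 * (D * \<delta>) \<le> 2 * b * norm m0 * (Q * \<Delta>)"
      using pos by (intro mult_left_mono) auto
    then show ?thesis by (simp add: mult_ac)
  qed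
  have "norm (m0 - p) + X + (c1 * (d + t) + c2 * \<delta>) * Y
      + 2 * (\<kappa> + D) * b * (g * X + \<delta> * norm m0 + ?N) =
      norm (m0 - p) + (c1 * Y) * d + (c2 * Y + 2 * \<kappa> * b * norm m0) * \<delta> +
      (X + c1 * Y * t + 2 * (\<kappa> + D) * b * (g * X + ?N) + 2 * D * b * (\<delta> * norm m0))"
    by (simp add: algebra_simps)
  also have "\<dots> \<le> norm (m0 - p) + (c1 * Y) * d + (c2 * Y + 2 * \<kappa> * b * norm m0) * \<delta> +
      (Q + c1 * Y * ((4 + 2 * \<kappa>) * Q) + 2 * (\<kappa> + 1) * b * (g + 1) * Q
        + 2 * b * norm m0 * \<Delta> * Q)"
    by (intro add_mono order_refl XQ 2 3 4)
  also have "\<dots> = norm (m0 - p) + (c1 * Y) * d + (c2 * Y + 2 * \<kappa> * b * norm m0) * \<delta> +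
    (1 + c1 * Y * (4 + 2 * \<kappa>) + 2 * (\<kappa> + 1) * b * (g + 1) + 2 * b * norm m0 * \<Delta>) * Q"
    by (simp add: algebra_simps)
  finally show ?thesis
    using 1 by (simp add: Q_def s_def R_def)
qed

end

section \<open>Gaussian moments\<close>

text \<open>The moments of a centred normal variable of variance \<open>v\<close>, recorded in place
  of the law so that the degenerate case v = 0, which has no density, is included.\<close>

definition centred_moments :: "'a measure \<Rightarrow> ('a \<Rightarrow> real) \<Rightarrow> real \<Rightarrow> bool" where
  "centred_moments M X v \<longleftrightarrow>
     has_bochner_integral M X 0 \<and> has_bochner_integral M (\<lambda>x. (X x)\<^sup>2) v \<and>
     has_bochner_integral M (\<lambda>x. X x ^ 4) (3 * v\<^sup>2)"

lemma centred_moments_zero: "centred_moments M (\<lambda>_. 0) 0"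
  by (simp add: centred_moments_def has_bochner_integral_zero)

lemma (in prob_space) centred_moments_normal:
  assumes D: "distributed M lborel X (normal_density 0 \<sigma>)" and \<sigma>: "0 < \<sigma>"
  shows "centred_moments M X (\<sigma>\<^sup>2)"
proof -
  have mom: "has_bochner_integral M (\<lambda>x. X x ^ k) c"
    if "has_bochner_integral lborel (\<lambda>x. normal_density 0 \<sigma> x * x ^ k) c" for k c
    using that distributed_integrable[OF D, of "\<lambda>x. x ^ k"]
      distributed_integral[OF D, of "\<lambda>x. x ^ k"]
    by (simp add: has_bochner_integral_iff)
  have "has_bochner_integral M (\<lambda>x. X x ^ 1) 0"
    by (rule mom) (use normal_moment_odd[OF \<sigma>, of 0 0] in simp)
  moreover have "has_bochner_integral M (\<lambda>x. X x ^ 2) (\<sigma>\<^sup>2)"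
    by (rule mom) (use normal_moment_even[OF \<sigma>, of 0 1] in simp)
  moreover have "has_bochner_integral M (\<lambda>x. X x ^ 4) (3 * (\<sigma>\<^sup>2)\<^sup>2)"
  proof (rule mom)
    have "fact (2 * 2) / ((2 / \<sigma>\<^sup>2)\<^sup>2 * fact 2) = 3 * (\<sigma>\<^sup>2)\<^sup>2"
      using \<sigma> by (simp add: fact_numeral power_divide field_simps)
    then show "has_bochner_integral lborel (\<lambda>x. normal_density 0 \<sigma> x * x ^ 4) (3 * (\<sigma>\<^sup>2)\<^sup>2)"
      using normal_moment_even[OF \<sigma>, of 0 2] by simp
  qed
  ultimately show ?thesis
    by (simp add: centred_moments_def)
qed

lemma prob_space_std_gaussian: "prob_space (std_gaussian I)"
  unfolding std_gaussian_def by (intro prob_space_PiM prob_space_normal_density) simp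

lemma measurable_std_gaussian_component:
  "i \<in> I \<Longrightarrow> (\<lambda>\<xi>. \<xi> i) \<in> borel_measurable (std_gaussian I)"
proof -
  assume i: "i \<in> I"
  have "(\<lambda>\<xi>. \<xi> i) \<in> measurable (std_gaussian I) (density lborel std_normal_density)"
    unfolding std_gaussian_def by (rule measurable_component_singleton[OF i])
  then show ?thesis by simp
qed

lemma distr_std_gaussian_component:
  assumes "i \<in> I"
  shows "distr (std_gaussian I) borel (\<lambda>\<xi>. \<xi> i) = density lborel std_normal_density"
proof -
  let ?N = "density lborel (\<lambda>x. ennreal (std_normal_density x))"
  have "distr (std_gaussian I) borel (\<lambda>\<xi>. \<xi> i) = distr (PiM I (\<lambda>_. ?N)) ?N (\<lambda>\<xi>. \<xi> i)"
    unfolding std_gaussian_def by (rule distr_cong) auto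
  also have "\<dots> = ?N"
    by (rule distr_PiM_component) (auto simp: prob_space_normal_density assms)
  finally show ?thesis .
qed

lemma distributed_std_gaussian_component:
  assumes "i \<in> I"
  shows "distributed (std_gaussian I) lborel (\<lambda>\<xi>. \<xi> i) std_normal_density"
proof -
  have "distr (std_gaussian I) lborel (\<lambda>\<xi>. \<xi> i) = distr (std_gaussian I) borel (\<lambda>\<xi>. \<xi> i)"
    by (rule distr_cong) auto
  then have "distr (std_gaussian I) lborel (\<lambda>\<xi>. \<xi> i) = density lborel std_normal_density"
    by (rule trans[OF _ distr_std_gaussian_component[OF assms]])
  moreover have "(\<lambda>\<xi>. \<xi> i) \<in> measurable (std_gaussian I) lborel"
    unfolding measurable_lborel1 by (rule measurable_std_gaussian_component[OF assms])
  moreover have "(\<lambda>x. ennreal (std_normal_density x)) \<in> borel_measurable lborel"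
    by measurable
  ultimately show ?thesis
    unfolding distributed_def by blast
qed

text \<open>Independence is read off from the joint law being the product of the marginals. That
  characterisation is for nonempty families, whence the separate empty case.\<close>

lemma indep_vars_std_gaussian:
  "prob_space.indep_vars (std_gaussian I) (\<lambda>_. borel) (\<lambda>i \<xi>. \<xi> i) I"
proof (cases "I = {}")
  case True
  then show ?thesis
    by (simp add: prob_space.indep_vars_def[OF prob_space_std_gaussian]
        prob_space.indep_sets_def[OF prob_space_std_gaussian])
next
  case False
  let ?N = "density lborel (\<lambda>x. ennreal (std_normal_density x))"
  have "distr (std_gaussian I) (PiM I (\<lambda>_. borel)) (\<lambda>x. \<lambda>i\<in>I. x i) =
      distr (std_gaussian I) (std_gaussian I) (\<lambda>x. x)"
    by (rule distr_cong)
      (auto simp: std_gaussian_def space_PiM restrict_PiE_iff extensional_restrict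
        PiE_def intro!: sets_PiM_cong)
  also have "\<dots> = PiM I (\<lambda>_. ?N)"
    by (simp add: distr_id std_gaussian_def)
  also have "\<dots> = PiM I (\<lambda>i. distr (std_gaussian I) borel (\<lambda>\<xi>. \<xi> i))"
    by (rule PiM_cong) (simp_all add: distr_std_gaussian_component)
  finally show ?thesis
    by (subst prob_space.indep_vars_iff_distr_eq_PiM'[OF prob_space_std_gaussian False])
      (auto intro: measurable_std_gaussian_component)
qed

lemma centred_moments_std_gaussian:
  assumes "finite I"
  shows "centred_moments (std_gaussian I) (\<lambda>\<xi>. \<Sum>i\<in>I. b i * \<xi> i) (\<Sum>i\<in>I. (b i)\<^sup>2)"
proof -
  interpret prob_space "std_gaussian I" by (rule prob_space_std_gaussian)
  \<comment> \<open>Sums of independent normal variables are handled through densities, which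
    require positive standard deviations; indices with zero coefficient are removed first.\<close>
  define K where "K = {i \<in> I. b i \<noteq> 0}"
  have K: "finite K" "K \<subseteq> I" using assms by (auto simp: K_def)
  have eq: "(\<Sum>i\<in>I. b i * \<xi> i) = (\<Sum>i\<in>K. b i * \<xi> i)" "(\<Sum>i\<in>I. (b i)\<^sup>2) = (\<Sum>i\<in>K. (b i)\<^sup>2)" for \<xi>
    using assms by (auto simp: K_def intro!: sum.mono_neutral_right)
  show ?thesis
  proof (cases "K = {}")
    case True
    then show ?thesis by (simp add: eq centred_moments_zero)
  next
    case False
    have "distributed (std_gaussian I) lborel (\<lambda>\<xi>. \<Sum>i\<in>K. b i * \<xi> i)
        (normal_density (\<Sum>i\<in>K. 0) (sqrt (\<Sum>i\<in>K. \<bar>b i\<bar>\<^sup>2)))"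
    proof (rule sum_indep_normal[OF K(1) False])
      show "indep_vars (\<lambda>i. borel) (\<lambda>i \<xi>. b i * \<xi> i) K"
        by (rule indep_vars_compose2[OF indep_vars_subset[OF indep_vars_std_gaussian K(2)]]) simp
      fix i
      assume i: "i \<in> K"
      then show "0 < \<bar>b i\<bar>" by (simp add: K_def)
      show "distributed (std_gaussian I) lborel (\<lambda>\<xi>. b i * \<xi> i) (normal_density 0 \<bar>b i\<bar>)"
        using normal_density_affine[OF distributed_std_gaussian_component[of i I], of "b i" 0] i
        by (simp add: K_def)
    qed
    moreover have "0 < (\<Sum>i\<in>K. (b i)\<^sup>2)"
      using K False by (intro sum_pos) (auto simp: K_def)
    ultimately show ?thesis
      using centred_moments_normal[of "\<lambda>\<xi>. \<Sum>i\<in>K. b i * \<xi> i" "sqrt (\<Sum>i\<in>K. (b i)\<^sup>2)"]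
      by (simp add: eq)
  qed
qed

lemma centred_moments_distr:
  assumes "T \<in> measurable M N" "g \<in> borel_measurable N"
  shows "centred_moments (distr M N T) g v \<longleftrightarrow> centred_moments M (\<lambda>x. g (T x)) v"
  using assms
  by (simp add: centred_moments_def has_bochner_integral_iff integrable_distr_eq integral_distr)

text \<open>Isserlis' formula for a pair, obtained by polarization from the moments of the four
  variables \<open>X\<close>, \<open>Y\<close>, \<open>X + Y\<close>, \<open>X - Y\<close>.\<close>

lemma centred_moments_product:
  assumes X: "centred_moments M X p" and Y: "centred_moments M Y q"
    and S: "centred_moments M (\<lambda>x. X x + Y x) (p + 2 * c + q)"
    and D: "centred_moments M (\<lambda>x. X x - Y x) (p - 2 * c + q)"
  shows "has_bochner_integral M (\<lambda>x. X x * Y x) c"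
    and "has_bochner_integral M (\<lambda>x. (X x * Y x)\<^sup>2) (p * q + 2 * c\<^sup>2)"
proof -
  have "has_bochner_integral M (\<lambda>x. ((X x + Y x)\<^sup>2 - (X x - Y x)\<^sup>2) * (1 / 4))
      ((p + 2 * c + q - (p - 2 * c + q)) * (1 / 4))"
    using S D unfolding centred_moments_def
    by (intro has_bochner_integral_mult_left has_bochner_integral_diff) auto
  moreover have "((X x + Y x)\<^sup>2 - (X x - Y x)\<^sup>2) * (1 / 4) = X x * Y x" for x
    by (simp add: power2_sum power2_diff)
  ultimately show "has_bochner_integral M (\<lambda>x. X x * Y x) c"
    by simp
  have "has_bochner_integral M
      (\<lambda>x. ((X x + Y x) ^ 4 + (X x - Y x) ^ 4 - (X x ^ 4 + Y x ^ 4) * 2) * (1 / 12))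
      ((3 * (p + 2 * c + q)\<^sup>2 + 3 * (p - 2 * c + q)\<^sup>2 - (3 * p\<^sup>2 + 3 * q\<^sup>2) * 2) * (1 / 12))"
    using X Y S D unfolding centred_moments_def
    by (intro has_bochner_integral_mult_left has_bochner_integral_diff
        has_bochner_integral_add) auto
  moreover have "((X x + Y x) ^ 4 + (X x - Y x) ^ 4 - (X x ^ 4 + Y x ^ 4) * 2) * (1 / 12)
      = (X x * Y x)\<^sup>2" for x
    by (simp add: power4_eq_xxxx power2_eq_square algebra_simps)
  moreover have "(3 * (p + 2 * c + q)\<^sup>2 + 3 * (p - 2 * c + q)\<^sup>2 - (3 * p\<^sup>2 + 3 * q\<^sup>2) * 2) * (1 / 12)
      = p * q + 2 * c\<^sup>2"
    by (simp add: power2_eq_square algebra_simps)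
  ultimately show "has_bochner_integral M (\<lambda>x. (X x * Y x)\<^sup>2) (p * q + 2 * c\<^sup>2)"
    by (simp only:)
qed

text \<open>Expanding the square, products with distinct indices have mean zero by independence, so
  J of the J^2 terms survive.\<close>

lemma (in prob_space) mean_square_average_le:
  fixes X :: "nat \<Rightarrow> 'a \<Rightarrow> real"
  assumes indep: "indep_vars (\<lambda>_. borel) X {..<J}" and J: "0 < J"
    and X: "\<And>j. j < J \<Longrightarrow> has_bochner_integral M (X j) 0"
    and X2: "\<And>j. j < J \<Longrightarrow> has_bochner_integral M (\<lambda>x. (X j x)\<^sup>2) v"
  shows "has_bochner_integral M (\<lambda>x. ((\<Sum>j<J. X j x) / real J)\<^sup>2) (v / real J)"
proof -
  have prod: "has_bochner_integral M (\<lambda>x. X i x * X j x) (if i = j then v else 0)"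
    if "i < J" "j < J" for i j
  proof (cases "i = j")
    case True
    then show ?thesis using X2[of i] that by (simp add: power2_eq_square)
  next
    case False
    have ij: "indep_vars (\<lambda>_. borel) X {i, j}"
      by (rule indep_vars_subset[OF indep]) (use that in auto)
    have int: "integrable M (X l)" if "l \<in> {i, j}" for l
      using that X \<open>i < J\<close> \<open>j < J\<close> by (auto simp: has_bochner_integral_iff)
    have "integrable M (\<lambda>x. \<Prod>l\<in>{i, j}. X l x)"
      by (rule indep_vars_integrable[OF _ ij int]) auto
    moreover have "(\<integral>x. (\<Prod>l\<in>{i, j}. X l x) \<partial>M) = (\<Prod>l\<in>{i, j}. \<integral>x. X l x \<partial>M)"
      by (rule indep_vars_lebesgue_integral[OF _ ij int]) auto
    ultimately show ?thesis
      using False X that by (simp add: has_bochner_integral_iff)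
  qed
  have "has_bochner_integral M (\<lambda>x. (\<Sum>i<J. \<Sum>j<J. X i x * X j x) * (1 / (real J)\<^sup>2))
      ((\<Sum>i<J. \<Sum>j<J. if i = j then v else 0) * (1 / (real J)\<^sup>2))"
    by (intro has_bochner_integral_mult_left has_bochner_integral_sum prod) auto
  moreover have "(\<Sum>i<J. \<Sum>j<J. X i x * X j x) * (1 / (real J)\<^sup>2) = ((\<Sum>j<J. X j x) / real J)\<^sup>2"
    for x
    by (simp add: power2_eq_square sum_product)
  moreover have "(\<Sum>i<J. \<Sum>j<J. if i = j then v else 0) * (1 / (real J)\<^sup>2) = v / real J"
    using J by (simp add: power2_eq_square)
  ultimately show ?thesis by simp
qed

section \<open>Measurability of the gain\<close>

lemma borel_measurable_det:
  fixes A :: "'a \<Rightarrow> real^'d^'d"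
  assumes [measurable]: "\<And>i j. (\<lambda>x. A x $ i $ j) \<in> borel_measurable M"
  shows "(\<lambda>x. det (A x)) \<in> borel_measurable M"
  unfolding det_def by measurable

text \<open>\<open>matrix_inv\<close> is a choice operator, so measurability must come from a
  formula. Cramer's rule writes each component as a quotient of determinants, which are polynomials
  in the entries.\<close>

lemma borel_measurable_matrix_inv_mult:
  fixes S :: "'a \<Rightarrow> real^'d^'d"
  assumes [measurable]: "\<And>i j. (\<lambda>x. S x $ i $ j) \<in> borel_measurable M"
    "\<And>i. (\<lambda>x. w x $ i) \<in> borel_measurable M"
    and inv: "\<And>x. invertible (S x)"
  shows "(\<lambda>x. (matrix_inv (S x) *v w x) $ k) \<in> borel_measurable M"
proof -
  have eq: "(matrix_inv (S x) *v w x) $ k =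
      det (\<chi> i j. if j = k then w x $ i else S x $ i $ j) / det (S x)" for x
  proof -
    have "S x ** matrix_inv (S x) = mat 1"
      using someI_ex[OF inv[unfolded invertible_def]] by (simp add: matrix_inv_def)
    then have "S x *v (matrix_inv (S x) *v w x) = w x"
      by (simp add: matrix_vector_mul_assoc)
    then have "matrix_inv (S x) *v w x =
        (\<chi> k. det (\<chi> i j. if j = k then w x $ i else S x $ i $ j) / det (S x))"
      using inv[of x] by (subst (asm) cramer) (simp_all add: invertible_det_nz)
    then show ?thesis by simp
  qed
  have [measurable]: "(\<lambda>x. det (\<chi> i j. if j = k then w x $ i else S x $ i $ j)) \<in> borel_measurable M"
    by (rule borel_measurable_det) (simp cong: measurable_cong_simp)
  have [measurable]: "(\<lambda>x. det (S x)) \<in> borel_measurable M"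
    by (rule borel_measurable_det) simp
  show ?thesis
    unfolding eq by measurable
qed

section \<open>Moments of the ensemble\<close>

lemma inner_sample_mean: "inner (sample_mean J w) h = (\<Sum>j<J. inner (w j) h) / real J"
  by (simp add: sample_mean_def inner_sum_left)

lemma (in prob_space) mean_square_sample_mean:
  fixes W :: "nat \<Rightarrow> 'a \<Rightarrow> 'h::{real_inner, second_countable_topology}"
  assumes E: "orthonormal_set E" and J: "0 < J"
    and W: "\<And>j \<omega>. j < J \<Longrightarrow> W j \<omega> \<in> span E"
    and indep: "indep_vars (\<lambda>_. borel) W {..<J}"
    and mom: "\<And>j h. j < J \<Longrightarrow> centred_moments M (\<lambda>\<omega>. inner (W j \<omega>) h) (q h h)"
  shows "has_bochner_integral M (\<lambda>\<omega>. (norm (sample_mean J (\<lambda>j. W j \<omega>)))\<^sup>2)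
    ((\<Sum>e\<in>E. q e e) / real J)"
proof -
  have "sample_mean J (\<lambda>j. W j \<omega>) \<in> span E" for \<omega>
    unfolding sample_mean_def by (intro span_scale span_sum W) simp
  then have "(norm (sample_mean J (\<lambda>j. W j \<omega>)))\<^sup>2 =
      (\<Sum>e\<in>E. ((\<Sum>j<J. inner (W j \<omega>) e) / real J)\<^sup>2)" for \<omega>
    by (simp add: norm_square_orthonormal_set[OF E] inner_sample_mean)
  moreover have "has_bochner_integral M (\<lambda>\<omega>. \<Sum>e\<in>E. ((\<Sum>j<J. inner (W j \<omega>) e) / real J)\<^sup>2)
      (\<Sum>e\<in>E. q e e / real J)"
  proof (intro has_bochner_integral_sum mean_square_average_le J)
    show "indep_vars (\<lambda>_. borel) (\<lambda>j \<omega>. inner (W j \<omega>) e) {..<J}" for e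
      by (rule indep_vars_compose2[OF indep]) simp
  qed (use mom in \<open>auto simp: centred_moments_def\<close>)
  ultimately show ?thesis
    by (simp add: sum_divide_distrib)
qed

text \<open>Each entry (e, f) is an average of the independent centred variables <W,e><W,f> -
  q(e,f), where q is the target form. By Isserlis' formula their variance is q(e,e) q(f,f) +
  q(e,f)^2.\<close>

lemma (in prob_space) mean_square_cov_dev:
  fixes W :: "nat \<Rightarrow> 'a \<Rightarrow> 'h::{real_inner, second_countable_topology}"
  assumes J: "0 < J"
    and indep: "indep_vars (\<lambda>_. borel) W {..<J}"
    and mom: "\<And>j h. j < J \<Longrightarrow> centred_moments M (\<lambda>\<omega>. inner (W j \<omega>) h) (cov_form {..<n} a h h)"
  shows "has_bochner_integral M (\<lambda>\<omega>. (cov_dev E J (\<lambda>j. W j \<omega>) n a)\<^sup>2)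
    ((\<Sum>e\<in>E. \<Sum>f\<in>E. cov_form {..<n} a e e * cov_form {..<n} a f f
        + (cov_form {..<n} a e f)\<^sup>2) / real J)"
proof -
  let ?q = "cov_form {..<n} a"
  define X where "X e f j \<omega> = inner (W j \<omega>) e * inner (W j \<omega>) f - ?q e f" for e f j \<omega>
  have "cov_form {..<J} (\<lambda>j. W j \<omega>) e f / real J - ?q e f = (\<Sum>j<J. X e f j \<omega>) / real J" for e f \<omega>
    using J by (simp add: X_def cov_form_def sum_subtractf diff_divide_distrib)
  then have "(cov_dev E J (\<lambda>j. W j \<omega>) n a)\<^sup>2 =
      (\<Sum>e\<in>E. \<Sum>f\<in>E. ((\<Sum>j<J. X e f j \<omega>) / real J)\<^sup>2)" for \<omega>
    by (simp add: cov_dev_def sum_nonneg)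
  moreover have "has_bochner_integral M (\<lambda>\<omega>. \<Sum>e\<in>E. \<Sum>f\<in>E. ((\<Sum>j<J. X e f j \<omega>) / real J)\<^sup>2)
      (\<Sum>e\<in>E. \<Sum>f\<in>E. (?q e e * ?q f f + (?q e f)\<^sup>2) / real J)"
  proof (intro has_bochner_integral_sum mean_square_average_le J)
    fix e f
    show "indep_vars (\<lambda>_. borel) (X e f) {..<J}"
      unfolding X_def by (rule indep_vars_compose2[OF indep]) simp
    fix j
    assume j: "j < J"
    let ?x = "\<lambda>\<omega>. inner (W j \<omega>) e" and ?y = "\<lambda>\<omega>. inner (W j \<omega>) f"
    have c: "has_bochner_integral M (\<lambda>_. c) c" for c :: real
      by (simp add: has_bochner_integral_iff prob_space)
    \<comment> \<open>Polarization needs the moments along \<open>e + f\<close> and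
      \<open>e - f\<close>, available because \<open>mom\<close> holds in every direction.\<close>
    have "?q (e + f) (e + f) = ?q e e + 2 * ?q e f + ?q f f"
      "?q (e - f) (e - f) = ?q e e - 2 * ?q e f + ?q f f"
      by (simp_all add: cov_form_def inner_add_right inner_diff_right algebra_simps
          sum.distrib sum_subtractf sum_distrib_left)
    with mom[OF j, of "e + f"] mom[OF j, of "e - f"]
    have sum: "centred_moments M (\<lambda>\<omega>. ?x \<omega> + ?y \<omega>) (?q e e + 2 * ?q e f + ?q f f)"
      and diff: "centred_moments M (\<lambda>\<omega>. ?x \<omega> - ?y \<omega>) (?q e e - 2 * ?q e f + ?q f f)"
      by (simp_all add: inner_add_right inner_diff_right)
    note prod = centred_moments_product[OF mom[OF j, of e] mom[OF j, of f] sum diff]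
    have "has_bochner_integral M (X e f j) (?q e f - ?q e f)"
      unfolding X_def by (intro has_bochner_integral_diff prod c)
    then show "has_bochner_integral M (X e f j) 0" by simp
    have "has_bochner_integral M
        (\<lambda>\<omega>. (?x \<omega> * ?y \<omega>)\<^sup>2 - (?x \<omega> * ?y \<omega>) * (2 * ?q e f) + (?q e f)\<^sup>2)
        (?q e e * ?q f f + 2 * (?q e f)\<^sup>2 - ?q e f * (2 * ?q e f) + (?q e f)\<^sup>2)"
      by (intro has_bochner_integral_add has_bochner_integral_diff
          has_bochner_integral_mult_left prod c)
    moreover have "(?x \<omega> * ?y \<omega>)\<^sup>2 - (?x \<omega> * ?y \<omega>) * (2 * ?q e f) + (?q e f)\<^sup>2 = (X e f j \<omega>)\<^sup>2" for \<omega>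
      by (simp add: X_def power2_diff)
    moreover have "?q e e * ?q f f + 2 * (?q e f)\<^sup>2 - ?q e f * (2 * ?q e f) + (?q e f)\<^sup>2 =
        ?q e e * ?q f f + (?q e f)\<^sup>2"
      by (simp add: power2_eq_square)
    ultimately show "has_bochner_integral M (\<lambda>\<omega>. (X e f j \<omega>)\<^sup>2) (?q e e * ?q f f + (?q e f)\<^sup>2)"
      by (simp only:)
  qed
  ultimately show ?thesis
    by (simp add: sum_divide_distrib)
qed

section \<open>Traces, and the law of the embedded ensemble\<close>

lemma sum_cov_form_diag:
  assumes E: "orthonormal_set E" and a: "\<And>l. l \<in> I \<Longrightarrow> a l \<in> span E"
  shows "(\<Sum>e\<in>E. cov_form I a e e) = (\<Sum>l\<in>I. (norm (a l))\<^sup>2)"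
  unfolding cov_form_def
  by (subst sum.swap) (simp add: power2_norm_eq_inner parseval_orthonormal_set[OF E a])

text \<open>By Cauchy-Schwarz q(e,f)^2 <= q(e,e) q(f,f), after which the double sum factors into the
  square of the trace. At this point the number of basis vectors disappears from the
  estimate.\<close>

lemma sum_cov_form_square_le:
  "(\<Sum>e\<in>E. \<Sum>f\<in>E. cov_form I a e e * cov_form I a f f + (cov_form I a e f)\<^sup>2)
    \<le> 2 * (\<Sum>e\<in>E. cov_form I a e e)\<^sup>2"
proof -
  have "(cov_form I a e f)\<^sup>2 \<le> cov_form I a e e * cov_form I a f f" for e f
    unfolding cov_form_def
    using Cauchy_Schwarz_ineq_sum[of "\<lambda>l. inner (a l) e" "\<lambda>l. inner (a l) f" I]
    by (simp add: power2_eq_square)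
  then have "(\<Sum>e\<in>E. \<Sum>f\<in>E. cov_form I a e e * cov_form I a f f + (cov_form I a e f)\<^sup>2)
      \<le> (\<Sum>e\<in>E. \<Sum>f\<in>E. 2 * (cov_form I a e e * cov_form I a f f))"
    by (intro sum_mono) (smt (verit))
  also have "\<dots> = 2 * (\<Sum>e\<in>E. cov_form I a e e)\<^sup>2"
    by (simp only: power2_eq_square sum_product) (simp only: sum_distrib_left)
  finally show ?thesis .
qed

context finite_basis
begin

abbreviation proj_op :: "(nat \<Rightarrow> nat \<Rightarrow> real) \<Rightarrow> 'h \<Rightarrow> 'h" where
  "proj_op A h \<equiv> synth n \<phi> (mat_vec n A (proj_coeffs n \<phi> h))"

text \<open>The columns of \<open>L\<close>, read as vectors a_l of the subspace, factor the
  operator into the sum of a_l (x) a_l. Since the matrix is L L^T M, its coordinate trace is the sum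
  of |a_l|^2, which ties it to the Hilbert space geometry although the basis is not
  orthonormal.\<close>

lemma proj_op_cov_form:
  assumes A: "\<And>i k. i < n \<Longrightarrow> k < n \<Longrightarrow> A i k = (\<Sum>p<n. (\<Sum>l<n. L i l * L p l) * gram \<phi> p k)"
  defines "a \<equiv> \<lambda>l. synth n \<phi> (\<lambda>i. L i l)"
  shows "inner (proj_op A h) k = cov_form {..<n} a h k"
    and "(\<Sum>i<n. A i i) = (\<Sum>l<n. (norm (a l))\<^sup>2)"
proof -
  have Ax: "mat_vec n A x i = (\<Sum>l<n. L i l * inner (a l) (synth n \<phi> x))" if "i < n" for x i
  proof -
    have "mat_vec n A x i = (\<Sum>k<n. \<Sum>p<n. \<Sum>l<n. L i l * (L p l * gram \<phi> p k * x k))"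
      using that by (simp add: mat_vec_def A sum_distrib_right sum_distrib_left mult_ac)
    also have "\<dots> = (\<Sum>p<n. \<Sum>k<n. \<Sum>l<n. L i l * (L p l * gram \<phi> p k * x k))"
      by (rule sum.swap)
    also have "\<dots> = (\<Sum>p<n. \<Sum>l<n. \<Sum>k<n. L i l * (L p l * gram \<phi> p k * x k))"
      by (intro sum.cong refl sum.swap)
    also have "\<dots> = (\<Sum>l<n. \<Sum>p<n. \<Sum>k<n. L i l * (L p l * gram \<phi> p k * x k))"
      by (rule sum.swap)
    finally show ?thesis
      by (simp add: a_def inner_synth inner_M_def sum_distrib_left)
  qed
  have "proj_op A h = (\<Sum>i<n. \<Sum>l<n. inner (a l) h *\<^sub>R L i l *\<^sub>R \<phi> i)"
    unfolding synth_def[of n \<phi> "mat_vec n A _"]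
    by (intro sum.cong refl)
      (simp add: Ax synth_proj_coeffs inner_orth_proj synth_in_V a_def scaleR_sum_left mult.commute)
  also have "\<dots> = (\<Sum>l<n. inner (a l) h *\<^sub>R a l)"
    by (subst sum.swap) (simp add: a_def synth_def scaleR_sum_right)
  finally show "inner (proj_op A h) k = cov_form {..<n} a h k"
    by (simp add: cov_form_def inner_sum_left)
  have "(\<Sum>i<n. A i i) = (\<Sum>i<n. \<Sum>p<n. \<Sum>l<n. L p l * gram \<phi> p i * L i l)"
    by (simp add: A sum_distrib_right sum_distrib_left mult_ac)
  also have "\<dots> = (\<Sum>p<n. \<Sum>i<n. \<Sum>l<n. L p l * gram \<phi> p i * L i l)"
    by (rule sum.swap)
  also have "\<dots> = (\<Sum>p<n. \<Sum>l<n. \<Sum>i<n. L p l * gram \<phi> p i * L i l)"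
    by (intro sum.cong refl sum.swap)
  also have "\<dots> = (\<Sum>l<n. \<Sum>p<n. \<Sum>i<n. L p l * gram \<phi> p i * L i l)"
    by (rule sum.swap)
  finally show "(\<Sum>i<n. A i i) = (\<Sum>l<n. (norm (a l))\<^sup>2)"
    by (simp add: power2_norm_eq_inner a_def inner_synth inner_M_def)
qed

text \<open>A linear functional of the centred member is the combination of the independent normals
  with coefficients <a_l, h>. The variance is stated through \<open>A\<close>, because each member
  may come with its own factor \<open>L\<close>.\<close>

lemma centred_moments_gaussian_M:
  assumes G: "gaussian_M n \<phi> m A (distr M (Rn_borel n) u)"
    and u: "u \<in> measurable M (Rn_borel n)"
  shows "centred_moments M (\<lambda>\<omega>. inner (synth n \<phi> (u \<omega>) - synth n \<phi> m) h) (inner (proj_op A h) h)"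
proof -
  obtain L where A: "\<And>i k. i < n \<Longrightarrow> k < n \<Longrightarrow> A i k = (\<Sum>p<n. (\<Sum>l<n. L i l * L p l) * gram \<phi> p k)"
    and law: "distr M (Rn_borel n) u = distr (std_gaussian {..<n}) (Rn_borel n)
      (\<lambda>\<xi>. \<lambda>i\<in>{..<n}. m i + mat_vec n L \<xi> i)"
    using G unfolding gaussian_M_def by blast
  define a where "a l = synth n \<phi> (\<lambda>i. L i l)" for l
  define g where "g x = inner (synth n \<phi> x - synth n \<phi> m) h" for x
  have "g = (\<lambda>x. (\<Sum>i<n. x i * inner (\<phi> i) h) - inner (synth n \<phi> m) h)"
    by (simp add: fun_eq_iff g_def synth_def[of n \<phi> "_"] inner_diff_left inner_sum_left)
  then have g: "g \<in> borel_measurable (Rn_borel n)"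
    by (simp add: measurable_component_singleton)
  have T: "(\<lambda>\<xi>. \<lambda>i\<in>{..<n}. m i + mat_vec n L \<xi> i) \<in> measurable (std_gaussian {..<n}) (Rn_borel n)"
    unfolding mat_vec_def
    by (intro measurable_restrict borel_measurable_add borel_measurable_sum borel_measurable_times
        borel_measurable_const measurable_std_gaussian_component) auto
  have "g (\<lambda>i\<in>{..<n}. m i + mat_vec n L \<xi> i) = (\<Sum>l<n. inner (a l) h * \<xi> l)" for \<xi>
  proof -
    have "synth n \<phi> (\<lambda>i\<in>{..<n}. m i + mat_vec n L \<xi> i) =
        synth n \<phi> m + (\<Sum>i<n. \<Sum>l<n. \<xi> l *\<^sub>R L i l *\<^sub>R \<phi> i)"
      by (simp add: synth_def scaleR_add_left sum.distrib mat_vec_def scaleR_sum_left mult.commute)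
    also have "(\<Sum>i<n. \<Sum>l<n. \<xi> l *\<^sub>R L i l *\<^sub>R \<phi> i) = (\<Sum>l<n. \<xi> l *\<^sub>R a l)"
      by (subst sum.swap) (simp add: a_def synth_def scaleR_sum_right)
    finally show ?thesis
      unfolding g_def by (simp only: add_diff_cancel_left' inner_sum_left inner_scaleR_left mult.commute)
  qed
  moreover have "inner (proj_op A h) h = (\<Sum>l<n. (inner (a l) h)\<^sup>2)"
  proof -
    have "inner (proj_op A h) h = cov_form {..<n} (\<lambda>l. synth n \<phi> (\<lambda>i. L i l)) h h"
      by (rule proj_op_cov_form(1)) (rule A)
    then show ?thesis by (simp add: cov_form_def a_def power2_eq_square)
  qed
  ultimately have "centred_moments (std_gaussian {..<n})
      (\<lambda>\<xi>. g (\<lambda>i\<in>{..<n}. m i + mat_vec n L \<xi> i)) (inner (proj_op A h) h)"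
    using centred_moments_std_gaussian[of "{..<n}" "\<lambda>l. inner (a l) h"] by simp
  then have "centred_moments (distr M (Rn_borel n) u) g (inner (proj_op A h) h)"
    unfolding law centred_moments_distr[OF T g] .
  then show ?thesis
    unfolding centred_moments_distr[OF u g] by (simp add: g_def)
qed

text \<open>The i-th coefficient is the inner product with the i-th dual basis vector.\<close>

lemma proj_coeffs_bounded_linear: "bounded_linear (\<lambda>h. proj_coeffs n \<phi> h i)"
proof (cases "i < n")
  case True
  then obtain p where p: "p \<in> V" "\<And>k. k < n \<Longrightarrow> inner (\<phi> k) p = (if k = i then 1 else 0)"
    using dual_basis_exists by blast
  have "proj_coeffs n \<phi> h i = inner h p" for h
  proof -
    have "inner h p = inner (synth n \<phi> (proj_coeffs n \<phi> h)) p"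
      using inner_orth_proj[OF p(1), of h] by (simp add: synth_proj_coeffs inner_commute)
    also have "\<dots> = (\<Sum>k<n. if k = i then proj_coeffs n \<phi> h k else 0)"
      unfolding synth_def inner_sum_left by (rule sum.cong) (simp_all add: p(2))
    also have "\<dots> = proj_coeffs n \<phi> h i"
      using True by simp
    finally show ?thesis by simp
  qed
  then show ?thesis
    by (simp add: bounded_linear_inner_left)
qed (simp add: proj_coeffs_eq_0)

lemma proj_op_bounded_linear: "bounded_linear (proj_op A)"
  unfolding synth_def mat_vec_def
  by (intro bounded_linear_sum bounded_linear_compose[OF bounded_linear_scaleR_left]
      bounded_linear_const_mult proj_coeffs_bounded_linear)

lemma fwd_proj_coeffs_bounded_linear: "bounded_linear (\<lambda>h. fwd n F (proj_coeffs n \<phi> h))"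
  unfolding fwd_def
  by (intro bounded_linear_sum bounded_linear_compose[OF bounded_linear_scaleR_left]
      proj_coeffs_bounded_linear)

text \<open>The trace is effective dimension times operator norm. Undoing the division in
  \<open>eff_dim_M\<close> requires the norm to be nonzero, which positive definiteness provides
  once the dimension is positive.\<close>

lemma trace_le_eff_dim_M:
  assumes A: "covariance_M n \<phi> A" and n: "1 \<le> n"
    and \<kappa>: "\<And>h. norm (proj_op A h) \<le> \<kappa> * norm h" "0 \<le> \<kappa>"
    and K: "eff_dim_M n \<phi> A \<le> K"
  shows "(\<Sum>i<n. A i i) \<le> \<bar>K\<bar> * \<kappa>"
proof -
  define r where "r x = norm_M n \<phi> (mat_vec n A x) / norm_M n \<phi> x" for x
  \<comment> \<open>The supremum in \<open>opnorm_M\<close> includes vectors of M-norm zero, where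
    the quotient is 0 by the convention on division.\<close>
  have r_le: "r x \<le> \<kappa>" for x
  proof (cases "norm_M n \<phi> x = 0")
    case False
    then have "0 < norm_M n \<phi> x" by (metis norm_ge_zero norm_synth less_eq_real_def)
    then show ?thesis
      using \<kappa>(1)[of "synth n \<phi> x"]
      by (simp add: r_def mat_vec_proj_coeffs_synth norm_synth field_simps)
  qed (simp add: r_def \<kappa>)
  have op: "opnorm_M n \<phi> A = (SUP x. r x)"
    by (simp add: opnorm_M_def r_def)
  have op_le: "opnorm_M n \<phi> A \<le> \<kappa>"
    unfolding op by (rule cSUP_least) (auto intro: r_le)
  \<comment> \<open>The first unit vector; any vector with a nonzero coordinate below
    \<open>n\<close> would do as a witness for a positive quotient.\<close>
  define x where "x i = (if i = 0 then 1 else 0 :: real)" for i :: nat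
  have "0 < inner_M n \<phi> (mat_vec n A x) x"
    using A n by (auto simp: covariance_M_def x_def)
  then have "0 < norm (synth n \<phi> (mat_vec n A x)) * norm (synth n \<phi> x)"
    using norm_cauchy_schwarz[of "synth n \<phi> (mat_vec n A x)" "synth n \<phi> x"]
    by (simp add: inner_synth)
  then have "0 < r x"
    by (simp add: r_def zero_less_mult_iff flip: norm_synth)
  moreover have "r x \<le> opnorm_M n \<phi> A"
    unfolding op by (rule cSUP_upper) (auto intro!: bdd_aboveI r_le)
  ultimately have pos: "0 < opnorm_M n \<phi> A" by simp
  then have "(\<Sum>i<n. A i i) = eff_dim_M n \<phi> A * opnorm_M n \<phi> A"
    by (simp add: eff_dim_M_def)
  also have "\<dots> \<le> \<bar>K\<bar> * \<kappa>"
    using K pos op_le by (intro mult_mono) auto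
  finally show ?thesis .
qed

end

lemma centred_moments_gaussian_noise:
  fixes \<Gamma> :: "real^'d^'d"
  assumes G: "gaussian_noise \<Gamma> (distr M borel \<eta>)" and \<eta>: "\<eta> \<in> borel_measurable M"
  shows "centred_moments M (\<lambda>\<omega>. \<eta> \<omega> $ i) (\<Gamma> $ i $ i)"
proof -
  obtain S :: "real^'d^'d" where S: "\<Gamma> = S ** transpose S"
    and law: "distr M borel \<eta> = distr (std_gaussian UNIV) borel (\<lambda>\<zeta>. S *v (\<chi> i. \<zeta> i))"
    using G unfolding gaussian_noise_def by blast
  have g: "(\<lambda>x::real^'d. x $ i) \<in> borel_measurable borel"
    by simp
  have eq: "(S *v (\<chi> i. \<zeta> i)) = (\<Sum>k\<in>UNIV. \<zeta> k *\<^sub>R column k S)" for \<zeta>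
    by (simp add: vec_eq_iff matrix_vector_mult_def column_def mult.commute)
  have T: "(\<lambda>\<zeta>. S *v (\<chi> i. \<zeta> i)) \<in> borel_measurable (std_gaussian UNIV)"
    unfolding eq
    by (intro borel_measurable_sum borel_measurable_scaleR borel_measurable_const
        measurable_std_gaussian_component) auto
  have "centred_moments (std_gaussian UNIV) (\<lambda>\<zeta>. (S *v (\<chi> i. \<zeta> i)) $ i) (\<Gamma> $ i $ i)"
    using centred_moments_std_gaussian[of "UNIV :: 'd set" "\<lambda>k. S $ i $ k"]
    by (simp add: S matrix_vector_mult_def matrix_matrix_mult_def transpose_def power2_eq_square)
  then have "centred_moments (distr M borel \<eta>) (\<lambda>x. x $ i) (\<Gamma> $ i $ i)"
    unfolding law centred_moments_distr[OF T g] .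
  then show ?thesis
    unfolding centred_moments_distr[OF \<eta> g] .
qed

lemma (in prob_space) mean_square_noise:
  fixes \<eta> :: "nat \<Rightarrow> 'a \<Rightarrow> real^'d"
  assumes J: "0 < J" and indep: "indep_vars (\<lambda>_. borel) \<eta> {..<J}"
    and mom: "\<And>j i. j < J \<Longrightarrow> centred_moments M (\<lambda>\<omega>. \<eta> j \<omega> $ i) (\<Gamma> $ i $ i)"
  shows "has_bochner_integral M (\<lambda>\<omega>. (norm (sample_mean J (\<lambda>j. \<eta> j \<omega>)))\<^sup>2)
    ((\<Sum>i\<in>UNIV. \<Gamma> $ i $ i) / real J)"
proof -
  have norm2: "(norm v)\<^sup>2 = (\<Sum>i\<in>UNIV. (v $ i)\<^sup>2)" for v :: "real^'d"
    unfolding power2_norm_eq_inner inner_vec_def by (simp add: power2_eq_square)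
  have "(norm (sample_mean J (\<lambda>j. \<eta> j \<omega>)))\<^sup>2 =
      (\<Sum>i\<in>UNIV. ((\<Sum>j<J. \<eta> j \<omega> $ i) / real J)\<^sup>2)" for \<omega>
    unfolding norm2 by (simp add: sample_mean_def)
  moreover have "has_bochner_integral M (\<lambda>\<omega>. \<Sum>i\<in>UNIV. ((\<Sum>j<J. \<eta> j \<omega> $ i) / real J)\<^sup>2)
      (\<Sum>i\<in>UNIV. \<Gamma> $ i $ i / real J)"
  proof (intro has_bochner_integral_sum mean_square_average_le J)
    show "indep_vars (\<lambda>_. borel) (\<lambda>j \<omega>. \<eta> j \<omega> $ i) {..<J}" for i
      by (rule indep_vars_compose2[OF indep]) simp
  qed (use mom in \<open>auto simp: centred_moments_def\<close>)
  ultimately show ?thesis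
    by (simp add: sum_divide_distrib)
qed

section \<open>The expected error\<close>

lemma borel_measurable_sample_mean:
  fixes W :: "nat \<Rightarrow> 'a \<Rightarrow> 'b::{real_normed_vector, second_countable_topology}"
  assumes "\<And>j. j < J \<Longrightarrow> W j \<in> borel_measurable M"
  shows "(\<lambda>x. sample_mean J (\<lambda>j. W j x)) \<in> borel_measurable M"
  unfolding sample_mean_def
  using assms by (intro borel_measurable_scaleR borel_measurable_const borel_measurable_sum) auto

lemma borel_measurable_sample_cov:
  fixes W :: "nat \<Rightarrow> 'a \<Rightarrow> 'h::{real_inner, second_countable_topology}"
  assumes W: "\<And>j. j < J \<Longrightarrow> W j \<in> borel_measurable M" and f: "f \<in> borel_measurable M"
  shows "(\<lambda>x. sample_cov J (\<lambda>j. W j x) (f x)) \<in> borel_measurable M"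
  unfolding sample_cov_def
  using assms
  by (intro borel_measurable_scaleR borel_measurable_const borel_measurable_sum
      borel_measurable_inner borel_measurable_diff borel_measurable_sample_mean) auto

text \<open>Needed for the error to be a random variable at all. The sample covariance is
  nonnegative, so the innovation matrix is invertible for every outcome and the formula by
  determinants applies throughout.\<close>

lemma (in noise_lower_bound) borel_measurable_gain_sample_cov:
  fixes W :: "nat \<Rightarrow> 'a \<Rightarrow> 'h::{real_inner, second_countable_topology}"
    and G :: "'h \<Rightarrow> real^'d"
  assumes W: "\<And>j. j < J \<Longrightarrow> W j \<in> borel_measurable M" and J: "1 \<le> J"
    and w: "w \<in> borel_measurable M"
    and G: "bounded_linear G" and adj: "\<And>h w. inner (G h) w = inner h (G' w)"
  shows "(\<lambda>x. gain (sample_cov J (\<lambda>j. W j x)) G G' \<Gamma> (w x)) \<in> borel_measurable M"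
proof -
  define S where "S x = innovation_matrix (sample_cov J (\<lambda>j. W j x)) G G' \<Gamma>" for x
  have G_meas: "G \<in> borel_measurable borel"
    using G by (intro borel_measurable_continuous_onI linear_continuous_on)
  have G': "linear G'" by (rule adjoint_pair_linear[OF adj])
  have nth: "(\<lambda>x. f x $ i) \<in> borel_measurable M" if "f \<in> borel_measurable M"
    for f :: "'a \<Rightarrow> real^'d" and i
    using measurable_compose[OF that, of "\<lambda>v. v $ i" borel] by simp
  have "(\<lambda>x. S x $ i $ j) \<in> borel_measurable M" for i j
  proof -
    have "(\<lambda>x. G (sample_cov J (\<lambda>j. W j x) (G' (axis j 1)))) \<in> borel_measurable M"
      by (intro measurable_compose[OF borel_measurable_sample_cov G_meas] W) auto
    then have "(\<lambda>x. G (sample_cov J (\<lambda>j. W j x) (G' (axis j 1))) $ i) \<in> borel_measurable M"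
      by (rule nth)
    then show ?thesis
      by (simp add: S_def innovation_matrix_def matrix_def)
  qed
  moreover have "invertible (S x)" for x
    unfolding S_def using G adj J
    by (intro innovation_matrix_invertible sample_cov_linear sample_cov_nonneg)
      (auto simp: bounded_linear.linear)
  ultimately have v: "(\<lambda>x. (matrix_inv (S x) *v w x) $ k) \<in> borel_measurable M" for k
    using nth[OF w] by (intro borel_measurable_matrix_inv_mult)
  \<comment> \<open>Expanding in the standard basis of the data space reduces \<open>G'\<close> to
    finitely many fixed vectors with measurable scalar coefficients.\<close>
  have "G' v = (\<Sum>k\<in>UNIV. v $ k *\<^sub>R G' (axis k 1))" for v
  proof -
    have "G' v = G' (\<Sum>k\<in>UNIV. v $ k *\<^sub>R axis k 1)"
      by (simp add: basis_expansion flip: scalar_mult_eq_scaleR)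
    then show ?thesis
      by (simp add: linear_sum[OF G'] linear_scale[OF G'])
  qed
  then have "(\<lambda>x. G' (matrix_inv (S x) *v w x)) =
      (\<lambda>x. \<Sum>k\<in>UNIV. (matrix_inv (S x) *v w x) $ k *\<^sub>R G' (axis k 1))"
    by (rule ext)
  also have "\<dots> \<in> borel_measurable M"
    using v by (intro borel_measurable_sum borel_measurable_scaleR) auto
  finally show ?thesis
    unfolding gain_def S_def[symmetric] by (intro borel_measurable_sample_cov W)
qed

section \<open>Expectation of the pathwise bound\<close>

locale enkf_setting = finite_basis n \<phi> + noise_lower_bound \<Gamma> \<gamma>
  for n :: nat and \<phi> :: "nat \<Rightarrow> 'h::{real_inner, second_countable_topology}"
    and \<Gamma> :: "real^'d^'d" and \<gamma>
begin

text \<open>Taking expectations, E R = (tau + q + nu)/J with tau the trace, q the fourth-moment sum,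
  at most 2 t^2, and nu the trace of \<open>\<Gamma>\<close>. Hence s E R + 1/s = (tau + q + nu +
  1)/s for s = sqrt J, the origin of the last constant. Integrability is claimed too, since the
  integral of a non-integrable function is 0 by convention and the inequality alone would then carry
  no information.\<close>

lemma enkf_expected_error_le:
  fixes A :: "nat \<Rightarrow> nat \<Rightarrow> real" and F :: "nat \<Rightarrow> real^'d"
    and Cc :: "'h \<Rightarrow> 'h" and Fc :: "'h \<Rightarrow> real^'d"
  defines "G \<equiv> \<lambda>h. fwd n F (proj_coeffs n \<phi> h)"
  assumes ens: "enkf_ensemble M n \<phi> (proj_coeffs n \<phi> m0) A \<Gamma> J u \<eta>" and J: "2 \<le> J"
    and Cc: "linear Cc" "\<And>h. 0 \<le> inner (Cc h) h"
    and Fc: "linear Fc" "\<And>h w. inner (Fc h) w = inner h (adjoint Fc w)"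
    and a: "\<And>h. norm (Cc h) \<le> a * norm h" "0 \<le> a"
    and g: "\<And>h. norm (Fc h) \<le> g * norm h" "\<And>h. norm (G h) \<le> g * norm h" "0 \<le> g"
    and \<delta>: "\<And>h. norm (Fc h - G h) \<le> \<delta> * norm h" "0 \<le> \<delta>" "\<delta> \<le> \<Delta>"
    and d: "\<And>h. norm (Cc h - proj_op A h) \<le> d * norm h" "0 \<le> d"
    and \<kappa>: "\<And>h. norm (proj_op A h) \<le> \<kappa> * norm h" "0 \<le> \<kappa>"
    and tr: "(\<Sum>i<n. A i i) \<le> t"
    and c1: "c1 = g / \<gamma> + a * g * g\<^sup>2 / \<gamma>\<^sup>2"
    and c2: "c2 = a / \<gamma> + 2 * a * g * (a * g) / \<gamma>\<^sup>2"
    and Y: "Y = norm (y - Fc m0)" and b: "b = g / \<gamma>"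
    and c4: "c4 = 1 + c1 * Y * (4 + 2 * \<kappa>) + 2 * (\<kappa> + 1) * b * (g + 1) + 2 * b * norm m0 * \<Delta>"
  defines "err \<equiv> \<lambda>\<omega>. norm (posterior_mean Fc \<Gamma> Cc m0 y -
      synth n \<phi> (enkf_mean n \<phi> F \<Gamma> y J (\<lambda>j. u j \<omega>) (\<lambda>j. \<eta> j \<omega>)))"
  shows "integrable M err"
    and "integral\<^sup>L M err \<le> norm (m0 - orth_proj V m0) + (c1 * Y) * d
      + (c2 * Y + 2 * \<kappa> * b * norm m0) * \<delta>
      + c4 * (t + 2 * t\<^sup>2 + (\<Sum>i\<in>UNIV. \<Gamma> $ i $ i) + 1) * (1 / sqrt (real J))"
proof -
  interpret prob_space M using ens by (simp add: enkf_ensemble_def)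
  let ?m = "proj_coeffs n \<phi> m0"
  have indep_u: "indep_vars (\<lambda>_. Rn_borel n) u {..<J}" and indep_\<eta>: "indep_vars (\<lambda>_. borel) \<eta> {..<J}"
    and law_u: "\<And>j. j < J \<Longrightarrow> gaussian_M n \<phi> ?m A (distr M (Rn_borel n) (u j))"
    and law_\<eta>: "\<And>j. j < J \<Longrightarrow> gaussian_noise \<Gamma> (distr M borel (\<eta> j))"
    using ens by (auto simp: enkf_ensemble_def)
  have u_meas: "u j \<in> measurable M (Rn_borel n)" and \<eta>_meas: "\<eta> j \<in> borel_measurable M"
    if "j < J" for j
    using that indep_u indep_\<eta> by (auto simp: indep_vars_def)
  define p where "p = orth_proj V m0"
  define U where "U j \<omega> = synth n \<phi> (u j \<omega>)" for j \<omega>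
  define W where "W j \<omega> = U j \<omega> - p" for j \<omega>
  define G' where "G' w = synth n \<phi> (fwd_adj n \<phi> F w)" for w
  have G: "bounded_linear G"
    unfolding G_def by (rule fwd_proj_coeffs_bounded_linear)
  have adj: "inner (G h) w = inner h (G' w)" for h w
    unfolding G_def G'_def by (rule inner_fwd_proj_coeffs)
  have Gp: "G p = G m0"
    by (simp add: G_def p_def proj_coeffs_orth_proj)
  obtain E where E: "orthonormal_set E" "span E = V"
    using orthonormal_set_exists[of "\<phi> ` {..<n}"] by auto
  \<comment> \<open>The factor belongs to member 0, but the forms and traces derived from it depend
    on \<open>A\<close> alone and so serve all members.\<close>
  obtain L where "\<forall>i<n. \<forall>k<n. A i k = (\<Sum>p<n. (\<Sum>l<n. L i l * L p l) * gram \<phi> p k)"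
    using law_u[of 0] J unfolding gaussian_M_def by auto
  then have L: "\<And>i k. i < n \<Longrightarrow> k < n \<Longrightarrow> A i k = (\<Sum>p<n. (\<Sum>l<n. L i l * L p l) * gram \<phi> p k)"
    by blast
  define l where "l k = synth n \<phi> (\<lambda>i. L i k)" for k
  have T: "inner (proj_op A h) k = cov_form {..<n} l h k" for h k
    unfolding l_def by (rule proj_op_cov_form(1)) (rule L)
  have tr_l: "(\<Sum>i<n. A i i) = (\<Sum>k<n. (norm (l k))\<^sup>2)"
    unfolding l_def by (rule proj_op_cov_form(2)) (rule L)
  have l_V: "l k \<in> span E" for k
    by (simp add: l_def E(2) synth_in_V)
  have W_V: "W j \<omega> \<in> span E" for j \<omega>
    by (simp add: W_def U_def p_def E(2) span_diff synth_in_V orth_proj_in_V)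
  define \<tau> where "\<tau> = (\<Sum>e\<in>E. cov_form {..<n} l e e)"
  have \<tau>: "\<tau> \<le> t" "0 \<le> \<tau>"
    using tr by (auto simp: \<tau>_def sum_cov_form_diag[OF E(1) l_V] tr_l sum_nonneg)
  have synth_meas: "synth n \<phi> \<in> borel_measurable (Rn_borel n)"
    unfolding synth_def
    by (intro borel_measurable_sum borel_measurable_scaleR measurable_component_singleton
        borel_measurable_const) auto
  have U_meas: "U j \<in> borel_measurable M" if "j < J" for j
    unfolding U_def using measurable_compose[OF u_meas[OF that] synth_meas] .
  have indep_W: "indep_vars (\<lambda>_. borel) W {..<J}"
    unfolding W_def U_def
    by (rule indep_vars_compose2[OF indep_u]) (intro borel_measurable_diff synth_meas borel_measurable_const)
  have mom: "centred_moments M (\<lambda>\<omega>. inner (W j \<omega>) h) (cov_form {..<n} l h h)" if "j < J" for j h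
    using centred_moments_gaussian_M[OF law_u[OF that] u_meas[OF that], of h]
    by (simp add: T W_def U_def p_def synth_proj_coeffs)
  define X where "X \<omega> = norm (sample_mean J (\<lambda>j. W j \<omega>))" for \<omega>
  define D where "D \<omega> = cov_dev E J (\<lambda>j. W j \<omega>) n l" for \<omega>
  define N where "N \<omega> = norm (sample_mean J (\<lambda>j. \<eta> j \<omega>))" for \<omega>
  define R where "R \<omega> = (X \<omega>)\<^sup>2 + (D \<omega>)\<^sup>2 + (N \<omega>)\<^sup>2" for \<omega>
  define \<nu> where "\<nu> = (\<Sum>i\<in>UNIV. \<Gamma> $ i $ i)"
  define s where "s = sqrt (real J)"
  define base where "base = norm (m0 - p) + (c1 * Y) * d + (c2 * Y + 2 * \<kappa> * b * norm m0) * \<delta>"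
  have s: "0 < s" "s * s = real J" using J by (auto simp: s_def)
  define q where "q = (\<Sum>e\<in>E. \<Sum>f\<in>E. cov_form {..<n} l e e * cov_form {..<n} l f f
        + (cov_form {..<n} l e f)\<^sup>2)"
  have J0: "0 < J" using J by simp
  have R: "has_bochner_integral M R (\<tau> / real J + q / real J + \<nu> / real J)"
    unfolding R_def X_def D_def N_def \<tau>_def q_def \<nu>_def
    by (intro has_bochner_integral_add mean_square_sample_mean mean_square_cov_dev
        mean_square_noise E J0 W_V indep_W indep_\<eta> mom centred_moments_gaussian_noise
        law_\<eta> \<eta>_meas)
  have q: "q \<le> 2 * t\<^sup>2"
  proof -
    have "q \<le> 2 * \<tau>\<^sup>2"
      unfolding q_def \<tau>_def by (rule sum_cov_form_square_le)
    also have "\<dots> \<le> 2 * t\<^sup>2"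
      using \<tau> by (simp add: power_mono)
    finally show ?thesis .
  qed
  have err_eq: "err \<omega> = norm (m0 + gain Cc Fc (adjoint Fc) \<Gamma> (y - Fc m0) -
      (sample_mean J (\<lambda>j. U j \<omega>) + gain (sample_cov J (\<lambda>j. U j \<omega>)) G G' \<Gamma>
        (y - G (sample_mean J (\<lambda>j. U j \<omega>)) + sample_mean J (\<lambda>j. \<eta> j \<omega>))))" for \<omega>
    unfolding err_def posterior_mean_eq_gain synth_enkf_mean[OF J0] U_def G_def G'_def ..
  have bound: "err \<omega> \<le> base + c4 * (s * R \<omega> + 1 / s)" for \<omega>
  proof -
    \<comment> \<open>The update is written with the uncentred ensemble, the moments with the
      centred one; both have the same sample covariance.\<close>
    have cov: "sample_cov J (\<lambda>j. U j \<omega>) = sample_cov J (\<lambda>j. W j \<omega>)"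
      unfolding W_def by (rule sample_cov_shift[symmetric, OF J0])
    have X: "X \<omega> = norm (sample_mean J (\<lambda>j. U j \<omega>) - p)"
      by (simp add: X_def W_def sample_mean_diff J0)
    show ?thesis
      unfolding err_eq base_def c4 s_def R_def N_def p_def[symmetric]
    proof (rule enkf_error_le[where p = p and T = "proj_op A" and a = a and g = g and \<delta> = \<delta>
          and d = d and D = "D \<omega>" and X = "X \<omega>"])
      show "linear G" using G by (rule bounded_linear.linear)
      show "norm (proj_op A h - Cc h) \<le> d * norm h" for h
        using d(1)[of h] by (simp add: norm_minus_commute)
      show "norm (sample_cov J (\<lambda>j. U j \<omega>) h - proj_op A h) \<le>
          (2 * D \<omega> + \<kappa> / (real J - 1) + 2 * (X \<omega>)\<^sup>2) * norm h" for h
        unfolding cov D_def X_def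
        by (rule norm_sample_cov_diff_le[OF E(1) J W_V l_V T \<kappa>])
      show "norm (sample_cov J (\<lambda>j. U j \<omega>) h) \<le> 2 * (\<kappa> + D \<omega>) * norm h" for h
        unfolding cov D_def by (rule norm_sample_cov_le[OF E(1) J W_V l_V T \<kappa>])
      show "0 \<le> inner (sample_cov J (\<lambda>j. U j \<omega>) h) h" for h
        using J by (intro sample_cov_nonneg) simp
      show "0 \<le> D \<omega>" by (simp add: D_def cov_dev_nonneg)
    qed (fact Cc Fc a g \<delta> d \<kappa> J Gp X c1 c2 Y b adj sample_cov_linear)+
  qed
  have c4_nonneg: "0 \<le> c4"
    using a g \<delta> \<kappa> \<gamma>(1) by (auto simp: c4 c1 Y b intro!: add_nonneg_nonneg mult_nonneg_nonneg)
  have bound_int: "has_bochner_integral M (\<lambda>\<omega>. base + c4 * (s * R \<omega> + 1 / s))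
      (base + c4 * (s * (\<tau> / real J + q / real J + \<nu> / real J) + 1 / s))"
  proof -
    have c: "has_bochner_integral M (\<lambda>_. c) c" for c :: real
      by (simp add: has_bochner_integral_iff prob_space)
    show ?thesis
      by (intro has_bochner_integral_add has_bochner_integral_mult_right R c)
  qed
  have err_meas: "err \<in> borel_measurable M"
  proof -
    have G_meas: "G \<in> borel_measurable borel"
      using G by (intro borel_measurable_continuous_onI linear_continuous_on)
    have U: "(\<lambda>\<omega>. sample_mean J (\<lambda>j. U j \<omega>)) \<in> borel_measurable M"
      by (intro borel_measurable_sample_mean U_meas)
    have "(\<lambda>\<omega>. y - G (sample_mean J (\<lambda>j. U j \<omega>)) + sample_mean J (\<lambda>j. \<eta> j \<omega>)) \<in> borel_measurable M"
      by (intro borel_measurable_add borel_measurable_diff borel_measurable_const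
          borel_measurable_sample_mean \<eta>_meas measurable_compose[OF U G_meas])
    then have "(\<lambda>\<omega>. gain (sample_cov J (\<lambda>j. U j \<omega>)) G G' \<Gamma>
        (y - G (sample_mean J (\<lambda>j. U j \<omega>)) + sample_mean J (\<lambda>j. \<eta> j \<omega>))) \<in> borel_measurable M"
      using J by (intro borel_measurable_gain_sample_cov[OF U_meas _ _ G adj]) auto
    then have "(\<lambda>\<omega>. norm (m0 + gain Cc Fc (adjoint Fc) \<Gamma> (y - Fc m0) -
      (sample_mean J (\<lambda>j. U j \<omega>) + gain (sample_cov J (\<lambda>j. U j \<omega>)) G G' \<Gamma>
        (y - G (sample_mean J (\<lambda>j. U j \<omega>)) + sample_mean J (\<lambda>j. \<eta> j \<omega>))))) \<in> borel_measurable M"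
      using U by measurable
    then show ?thesis
      by (simp only: err_eq[abs_def])
  qed
  show int: "integrable M err"
  proof (rule Bochner_Integration.integrable_bound[OF _ err_meas])
    show "integrable M (\<lambda>\<omega>. base + c4 * (s * R \<omega> + 1 / s))"
      using bound_int by (simp only: has_bochner_integral_iff)
    show "AE \<omega> in M. norm (err \<omega>) \<le> norm (base + c4 * (s * R \<omega> + 1 / s))"
      using bound by (intro AE_I2) (auto simp: err_def intro: order_trans[OF _ abs_ge_self])
  qed
  have "integral\<^sup>L M err \<le> base + c4 * (s * (\<tau> / real J + q / real J + \<nu> / real J) + 1 / s)"
    using integral_mono[OF int _ bound] bound_int by (simp add: has_bochner_integral_iff)
  also have "s * (\<tau> / real J + q / real J + \<nu> / real J) + 1 / s = (\<tau> + q + \<nu> + 1) * (1 / s)"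
  proof -
    have "s / real J = 1 / s" using s by (simp flip: s(2))
    moreover have "s * (\<tau> / real J + q / real J + \<nu> / real J) = (\<tau> + q + \<nu>) * (s / real J)"
      by (simp add: mult.commute flip: add_divide_distrib)
    ultimately show ?thesis by (simp only: distrib_right mult_1_left)
  qed
  also have "base + c4 * ((\<tau> + q + \<nu> + 1) * (1 / s)) \<le> base + c4 * ((t + 2 * t\<^sup>2 + \<nu> + 1) * (1 / s))"
    using \<tau> q s c4_nonneg by (intro add_left_mono mult_left_mono mult_right_mono) auto
  finally show "integral\<^sup>L M err \<le> norm (m0 - orth_proj V m0) + (c1 * Y) * d
      + (c2 * Y + 2 * \<kappa> * b * norm m0) * \<delta>
      + c4 * (t + 2 * t\<^sup>2 + (\<Sum>i\<in>UNIV. \<Gamma> $ i $ i) + 1) * (1 / sqrt (real J))"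
    by (simp add: base_def p_def \<nu>_def s_def mult.assoc)
qed

end

section \<open>Constants uniform in n and J\<close>

lemma convergent_bounded:
  fixes X :: "nat \<Rightarrow> real"
  assumes "X \<longlonglongrightarrow> l"
  shows "\<exists>K. (\<forall>n. \<bar>X n\<bar> \<le> K) \<and> 0 \<le> K"
proof -
  have "Bseq X" using assms by (rule convergent_imp_Bseq[OF convergentI])
  then show ?thesis by (auto simp: Bseq_def intro: less_imp_le)
qed

text \<open>The effective dimension is controlled only for large n, while the constants must serve
  all n; the finitely many exceptions go into a maximum.\<close>

lemma eventually_le_imp_bounded_above:
  fixes X :: "nat \<Rightarrow> real"
  assumes "\<forall>\<^sub>F n in sequentially. X n \<le> c"
  shows "\<exists>K. \<forall>n. X n \<le> K"
proof -
  obtain N where N: "\<And>n. N \<le> n \<Longrightarrow> X n \<le> c"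
    using assms by (auto simp: eventually_sequentially)
  have "X n \<le> max c (Max (X ` {..N}))" for n
    using N[of n] by (cases "N \<le> n") (auto intro: le_max_iff_disj[THEN iffD2])
  then show ?thesis by blast
qed

theorem theorem4p1:
  fixes Fc :: "'h::{real_inner, complete_space, second_countable_topology} \<Rightarrow> real^'d"
    and \<Gamma> :: "real^'d^'d" and y :: "real^'d"
    and m0 :: 'h and Cc :: "'h \<Rightarrow> 'h"
    and \<phi> :: "nat \<Rightarrow> nat \<Rightarrow> 'h"
    and F :: "nat \<Rightarrow> nat \<Rightarrow> real^'d"
    and C :: "nat \<Rightarrow> nat \<Rightarrow> nat \<Rightarrow> real"
    and \<iota> :: "'k::{real_inner, complete_space} \<Rightarrow> 'h"
    and r1 r2 r3 :: real and \<psi>1 \<psi>2 \<psi>3 :: "nat \<Rightarrow> real"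
  assumes infinite_dim: "\<not> (\<exists>B::'h set. finite B \<and> span B = UNIV)"
    and forward: "bounded_linear Fc"
    and noise_cov: "pos_def_matrix \<Gamma>"
    and prior_cov: "trace_class_covariance Cc"
    and prior_mean: "m0 \<in> range (op_sqrt Cc)"
    and bases: "\<And>n. n \<ge> 1 \<Longrightarrow> basis_family n (\<phi> n)"
    and discr_cov: "\<And>n. n \<ge> 1 \<Longrightarrow> covariance_M n (\<phi> n) (C n)"
    and psi1: "\<psi>1 \<longlonglongrightarrow> 0"
    and cov_approx: "\<And>n. n \<ge> 1 \<Longrightarrow>
      onorm (\<lambda>u. Cc u - synth n (\<phi> n) (mat_vec n (C n) (proj_coeffs n (\<phi> n) u))) \<le> r1 * \<psi>1 n"
    and psi2: "\<psi>2 \<longlonglongrightarrow> 0"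
    and fwd_approx: "\<And>n. n \<ge> 1 \<Longrightarrow>
      onorm (\<lambda>u. Fc u - fwd n (F n) (proj_coeffs n (\<phi> n) u)) \<le> r2 * \<psi>2 n"
    and embedding: "bounded_linear \<iota>" "inj \<iota>"
    and prior_mean_regular: "m0 \<in> range \<iota>"
    and psi3: "\<psi>3 \<longlonglongrightarrow> 0"
    and proj_approx: "\<And>n u. n \<ge> 1 \<Longrightarrow>
      norm (\<iota> u - synth n (\<phi> n) (proj_coeffs n (\<phi> n) (\<iota> u))) \<le> r3 * \<psi>3 n * norm u"
    and eff_dims: "\<exists>c. \<forall>\<^sub>F n in sequentially. eff_dim_M n (\<phi> n) (C n) \<le> c * eff_dim Cc"
  shows "\<exists>r1' r2' r3' r4' :: real. \<forall>n\<ge>1. \<forall>J\<ge>2. eff_dim_M n (\<phi> n) (C n) \<le> real J \<longrightarrow>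
    (\<forall>(\<Omega> :: 'w measure) u \<eta>.
      enkf_ensemble \<Omega> n (\<phi> n) (proj_coeffs n (\<phi> n) m0) (C n) \<Gamma> J u \<eta> \<longrightarrow>
      (let err = (\<lambda>\<omega>. norm (posterior_mean Fc \<Gamma> Cc m0 y -
              synth n (\<phi> n) (enkf_mean n (\<phi> n) (F n) \<Gamma> y J (\<lambda>j. u j \<omega>) (\<lambda>j. \<eta> j \<omega>))))
       in integrable \<Omega> err \<and>
          prob_space.expectation \<Omega> err
            \<le> r1' * \<psi>1 n + r2' * \<psi>2 n + r3' * \<psi>3 n + r4' * (1 / sqrt (real J))))"
proof -
  have Cc: "bounded_linear Cc" "\<And>h. 0 \<le> inner (Cc h) h"
    using prior_cov by (auto simp: trace_class_covariance_def psd_op_def)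
  obtain \<gamma> where \<gamma>: "0 < \<gamma>" "\<And>w. \<gamma> * (norm w)\<^sup>2 \<le> inner w (\<Gamma> *v w)"
    using pos_def_matrix_lower_bound[OF noise_cov] by blast
  obtain K1 where K1: "\<And>n. \<bar>\<psi>1 n\<bar> \<le> K1" "0 \<le> K1"
    using convergent_bounded[OF psi1] by blast
  obtain K2 where K2: "\<And>n. \<bar>\<psi>2 n\<bar> \<le> K2" "0 \<le> K2"
    using convergent_bounded[OF psi2] by blast
  obtain c where "\<forall>\<^sub>F n in sequentially. eff_dim_M n (\<phi> n) (C n) \<le> c * eff_dim Cc"
    using eff_dims by blast
  then obtain K where K: "\<And>n. eff_dim_M n (\<phi> n) (C n) \<le> K"
    using eventually_le_imp_bounded_above[of "\<lambda>n. eff_dim_M n (\<phi> n) (C n)"] by blast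
  obtain k where k: "m0 = \<iota> k"
    using prior_mean_regular by blast
  \<comment> \<open>All constants are fixed before n and J. Convergent rates are bounded, so for all
    n >= 1 \<open>g\<close> bounds the exact and every discrete forward map, \<open>\<kappa>\<close>
    every discretised covariance operator, and \<open>t\<close> every trace.\<close>
  define a where "a = onorm Cc"
  define \<Delta> where "\<Delta> = \<bar>r2\<bar> * K2"
  define g where "g = onorm Fc + \<Delta>"
  define \<kappa> where "\<kappa> = a + \<bar>r1\<bar> * K1"
  define t where "t = \<bar>K\<bar> * \<kappa>"
  define c1 where "c1 = g / \<gamma> + a * g * g\<^sup>2 / \<gamma>\<^sup>2"
  define c2 where "c2 = a / \<gamma> + 2 * a * g * (a * g) / \<gamma>\<^sup>2"
  define Y where "Y = norm (y - Fc m0)"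
  define b where "b = g / \<gamma>"
  define c4 where "c4 = 1 + c1 * Y * (4 + 2 * \<kappa>) + 2 * (\<kappa> + 1) * b * (g + 1)
    + 2 * b * norm m0 * \<Delta>"
  define R4 where "R4 = c4 * (t + 2 * t\<^sup>2 + (\<Sum>i\<in>UNIV. \<Gamma> $ i $ i) + 1)"
  have a: "norm (Cc h) \<le> a * norm h" "0 \<le> a" for h
    using onorm[OF Cc(1)] onorm_pos_le[OF Cc(1)] by (auto simp: a_def)
  have \<Delta>: "0 \<le> \<Delta>" using K2 by (simp add: \<Delta>_def)
  have Fc_le: "norm (Fc h) \<le> onorm Fc * norm h" "0 \<le> onorm Fc" for h
    using onorm[OF forward] onorm_pos_le[OF forward] by auto
  have \<kappa>: "0 \<le> \<kappa>" using a(2) K1 by (simp add: \<kappa>_def)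
  have main: "integrable \<Omega> err \<and> prob_space.expectation \<Omega> err \<le>
      (c1 * Y * r1) * \<psi>1 n + ((c2 * Y + 2 * \<kappa> * b * norm m0) * r2) * \<psi>2 n
      + (r3 * norm k) * \<psi>3 n + R4 * (1 / sqrt (real J))"
    if n: "1 \<le> n" and J: "2 \<le> J"
      and ens: "enkf_ensemble \<Omega> n (\<phi> n) (proj_coeffs n (\<phi> n) m0) (C n) \<Gamma> J u \<eta>"
      and err: "err = (\<lambda>\<omega>. norm (posterior_mean Fc \<Gamma> Cc m0 y -
        synth n (\<phi> n) (enkf_mean n (\<phi> n) (F n) \<Gamma> y J (\<lambda>j. u j \<omega>) (\<lambda>j. \<eta> j \<omega>))))"
    for n J and \<Omega> :: "'w measure" and u \<eta> err
  proof -
    interpret enkf_setting n "\<phi> n" \<Gamma> \<gamma>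
      using bases[OF n] \<gamma> by unfold_locales auto
    let ?G = "\<lambda>h. fwd n (F n) (proj_coeffs n (\<phi> n) h)"
    have bl1: "bounded_linear (\<lambda>h. Cc h - proj_op (C n) h)"
      by (intro bounded_linear_sub Cc proj_op_bounded_linear)
    have bl2: "bounded_linear (\<lambda>h. Fc h - ?G h)"
      by (intro bounded_linear_sub forward fwd_proj_coeffs_bounded_linear)
    have d: "norm (Cc h - proj_op (C n) h) \<le> (r1 * \<psi>1 n) * norm h" for h
      by (rule order_trans[OF onorm[OF bl1] mult_right_mono[OF cov_approx[OF n]]]) simp
    \<comment> \<open>\<open>r1\<close> and the rate may be negative separately; their product
      bounds an operator norm and so cannot be.\<close>
    have d0: "0 \<le> r1 * \<psi>1 n"
      using onorm_pos_le[OF bl1] cov_approx[OF n] by linarith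
    have \<delta>: "norm (Fc h - ?G h) \<le> (r2 * \<psi>2 n) * norm h" for h
      by (rule order_trans[OF onorm[OF bl2] mult_right_mono[OF fwd_approx[OF n]]]) simp
    have \<delta>0: "0 \<le> r2 * \<psi>2 n"
      using onorm_pos_le[OF bl2] fwd_approx[OF n] by linarith
    have abs_le: "r * z \<le> \<bar>r\<bar> * B" if "\<bar>z\<bar> \<le> B" for r z B :: real
      using mult_left_mono[OF that, of "\<bar>r\<bar>"] abs_ge_self[of "r * z"] by (simp add: abs_mult)
    have d_le: "r1 * \<psi>1 n \<le> \<bar>r1\<bar> * K1" and \<delta>_le: "r2 * \<psi>2 n \<le> \<Delta>"
      unfolding \<Delta>_def by (rule abs_le[OF K1(1)], rule abs_le[OF K2(1)])
    have G_le: "norm (?G h) \<le> g * norm h" for h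
    proof -
      have "norm (?G h) \<le> norm (Fc h) + norm (Fc h - ?G h)"
        using norm_triangle_ineq4[of "Fc h" "Fc h - ?G h"] by simp
      also have "\<dots> \<le> onorm Fc * norm h + \<Delta> * norm h"
        by (intro add_mono Fc_le order_trans[OF \<delta>] mult_right_mono \<delta>_le) simp
      finally show ?thesis by (simp add: g_def distrib_right)
    qed
    have T_le: "norm (proj_op (C n) h) \<le> \<kappa> * norm h" for h
    proof -
      have "norm (proj_op (C n) h) \<le> norm (Cc h) + norm (Cc h - proj_op (C n) h)"
        using norm_triangle_ineq4[of "Cc h" "Cc h - proj_op (C n) h"] by simp
      also have "\<dots> \<le> a * norm h + \<bar>r1\<bar> * K1 * norm h"
        by (intro add_mono a order_trans[OF d] mult_right_mono d_le) simp
      finally show ?thesis by (simp add: \<kappa>_def distrib_right)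
    qed
    have g0: "0 \<le> g" using Fc_le \<Delta> by (simp add: g_def)
    have Fc_g: "norm (Fc h) \<le> g * norm h" for h
      by (rule order_trans[OF Fc_le(1)]) (simp add: g_def mult_right_mono \<Delta>)
    have tr: "(\<Sum>i<n. C n i i) \<le> t"
      unfolding t_def by (rule trace_le_eff_dim_M[OF discr_cov[OF n] n T_le \<kappa> K])
    note E = enkf_expected_error_le[OF ens J bounded_linear.linear[OF Cc(1)] Cc(2)
        bounded_linear.linear[OF forward] inner_adjoint[OF forward] a Fc_g G_le g0
        \<delta> \<delta>0 \<delta>_le d d0 T_le \<kappa> tr c1_def c2_def Y_def b_def c4_def, folded err]
    \<comment> \<open>Regularity of the prior mean enters here: \<open>m0\<close> is the image of
      \<open>k\<close>, whose norm becomes part of the third constant.\<close>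
    have "norm (m0 - orth_proj V m0) \<le> r3 * \<psi>3 n * norm k"
      using proj_approx[OF n, of k] by (simp add: k synth_proj_coeffs)
    with E show ?thesis
      by (simp add: R4_def mult_ac)
  qed
  show ?thesis
    unfolding Let_def
    by (rule exI[of _ "c1 * Y * r1"], rule exI[of _ "(c2 * Y + 2 * \<kappa> * b * norm m0) * r2"],
        rule exI[of _ "r3 * norm k"], rule exI[of _ R4]) (use main in blast)
qed

end
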